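(* Let $\mathcal{A}=\bigcup_\alpha X_\alpha$ be a unital strong algebra and let $\mathcal{U}=\bigcup_\alpha Y_\alpha$ be the Wiener algebra associated to $\mathcal{A}$. For any $a\in\mathcal{U}$, $a$ is invertible (from both sides) in $\mathcal{U}$ if and only if $a(t)$ is invertible (from both sides) in $\mathcal{A}$ for every $t\in[-\pi,\pi)$.
   Context: Inductive limit of Banach spaces: a complex vector space $X$ with a family $\{X_\alpha:\alpha\in A\}$ of subspaces, $X_\alpha\ne X_\beta$ for $\alpha\neq\beta$, directed under inclusion, with $X=\bigcup_\alpha X_\alpha$; the index set $A$ is directed by $\alpha\le\beta$ iff $X_\alpha\subseteq X_\beta$. Each $X_\alpha$ is a Banach space with norm $\|\cdot\|_\alpha$, and whenever $\alpha\le\beta$ the topology induced by $\|\cdot\|_\beta$ on $X_\alpha$ is coarser than that induced by $\|\cdot\|_\alpha$. $X$ carries the inductive limit topology: the finest locally convex topology making all inclusions $X_\alpha\hookrightarrow X$ continuous. Strong algebra: an inductive limit $\mathcal{A}=\bigcup_{\alpha\in A} X_\alpha$ of Banach spaces which is also an (associative) algebra such that for any $\alpha\in A$ there exists $h(\alpha)\in A$ such that for any $\beta\ge h(\alpha)$ there is a positive constant $A_{\beta,\alpha}$ with $\|ab\|_\beta\le A_{\beta,\alpha}\|a\|_\alpha\|b\|_\beta$ and $\|ba\|_\beta\le A_{\beta,\alpha}\|a\|_\alpha\|b\|_\beta$ for every $a\in X_\alpha$, $b\in X_\beta$. Unital means that $\mathcal{A}$ has a multiplicative unit $1$. Wiener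 algebra associated to $\mathcal{A}$: $Y_\alpha$ is the Banach space of periodic functions $a(t)=\sum_{n\in\mathbb{Z}}a_ne^{int}$, $a_n\in X_\alpha$, on $-\pi\le t<\pi$ to $\mathcal{A}$, with $\|a\|_\alpha=\sum_{n\in\mathbb{Z}}\|a_n\|_\alpha<\infty$; $\mathcal{U}=\bigcup_\alpha Y_\alpha$ is the inductive limit of the Banach spaces $Y_\alpha$, with pointwise multiplication. *)

theory Defs
  imports "HOL-Analysis.Analysis" "HOL-Library.Function_Algebras"
begin

text \<open>
  A subspace \<open>V\<close> of a complex vector space, with a norm \<open>N\<close> that is only meaningful on \<open>V\<close>.
  \<^const>\<open>Metric_space\<close> wants a distance that is nonnegative and symmetric everywhere, so the
  distance is set to \<open>0\<close> off \<open>V\<close>; those values play no role.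
\<close>

definition norm_dist :: "'a::ab_group_add set \<Rightarrow> ('a \<Rightarrow> real) \<Rightarrow> 'a \<Rightarrow> 'a \<Rightarrow> real" where
  "norm_dist V N x y = (if x \<in> V \<and> y \<in> V then N (x - y) else 0)"

definition norm_topology :: "'a::ab_group_add set \<Rightarrow> ('a \<Rightarrow> real) \<Rightarrow> 'a topology" where
  "norm_topology V N = Metric_space.mtopology V (norm_dist V N)"

locale complex_normed_subspace = vector_space smul
  for smul :: "complex \<Rightarrow> 'a::ab_group_add \<Rightarrow> 'a" +
  fixes V :: "'a set" and N :: "'a \<Rightarrow> real"
  assumes subspace: "subspace V"
    and norm_eq_0: "x \<in> V \<Longrightarrow> N x = 0 \<longleftrightarrow> x = 0"
    and norm_scale: "x \<in> V \<Longrightarrow> N (smul c x) = cmod c * N x"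
    and norm_triangle: "x \<in> V \<Longrightarrow> y \<in> V \<Longrightarrow> N (x + y) \<le> N x + N y"
begin

lemma norm_minus: "x \<in> V \<Longrightarrow> N (- x) = N x"
  using norm_scale[of x "-1"] by simp

lemma norm_nonneg: "x \<in> V \<Longrightarrow> 0 \<le> N x"
  using norm_triangle[of x "- x"] norm_minus[of x] norm_eq_0[of 0]
    subspace_0[OF subspace] subspace_neg[OF subspace, of x] by simp

lemma Metric_space_norm_dist: "Metric_space V (norm_dist V N)"
proof
  show "0 \<le> norm_dist V N x y" for x y
    using norm_nonneg[of "x - y"] subspace_diff[OF subspace] by (simp add: norm_dist_def)
  show "norm_dist V N x y = norm_dist V N y x" for x y
    using norm_minus[of "x - y"] subspace_diff[OF subspace] by (simp add: norm_dist_def)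
  show "norm_dist V N x y = 0 \<longleftrightarrow> x = y" if "x \<in> V" "y \<in> V" for x y
    using that norm_eq_0[of "x - y"] subspace_diff[OF subspace] by (simp add: norm_dist_def)
  show "norm_dist V N x z \<le> norm_dist V N x y + norm_dist V N y z"
    if "x \<in> V" "y \<in> V" "z \<in> V" for x y z
    using that norm_triangle[of "x - y" "y - z"] subspace_diff[OF subspace]
    by (simp add: norm_dist_def)
qed

end

locale complex_banach_subspace = complex_normed_subspace +
  assumes complete: "Metric_space.mcomplete V (norm_dist V N)"

text \<open>
  The inductive limit is the whole type \<open>'a\<close>, presented by the spaces \<open>X \<alpha>\<close>, \<open>\<alpha> \<in> I\<close>, with norms
  \<open>nrm \<alpha>\<close>; the order \<open>\<alpha> \<le> \<beta>\<close> on indices is \<open>X \<alpha> \<subseteq> X \<beta>\<close>.  The inductive limit topology on \<open>'a\<close>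
  is determined by these data and imposes no condition on them, so it is not a parameter.
\<close>

locale banach_inductive_limit = vector_space smul
  for smul :: "complex \<Rightarrow> 'a::ab_group_add \<Rightarrow> 'a" +
  fixes I :: "'i set" and X :: "'i \<Rightarrow> 'a set" and nrm :: "'i \<Rightarrow> 'a \<Rightarrow> real"
  assumes banach: "\<alpha> \<in> I \<Longrightarrow> complex_banach_subspace smul (X \<alpha>) (nrm \<alpha>)"
    and distinct: "inj_on X I"
    and directed: "\<alpha> \<in> I \<Longrightarrow> \<beta> \<in> I \<Longrightarrow> \<exists>\<gamma>\<in>I. X \<alpha> \<subseteq> X \<gamma> \<and> X \<beta> \<subseteq> X \<gamma>"
    and union: "(\<Union>\<alpha>\<in>I. X \<alpha>) = UNIV"
    and coarser: "\<alpha> \<in> I \<Longrightarrow> \<beta> \<in> I \<Longrightarrow> X \<alpha> \<subseteq> X \<beta> \<Longrightarrow>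
      openin (subtopology (norm_topology (X \<beta>) (nrm \<beta>)) (X \<alpha>)) U \<Longrightarrow>
      openin (norm_topology (X \<alpha>) (nrm \<alpha>)) U"

locale strong_algebra = banach_inductive_limit smul I X nrm
  for smul :: "complex \<Rightarrow> 'a::ring \<Rightarrow> 'a"
    and I :: "'i set" and X :: "'i \<Rightarrow> 'a set" and nrm :: "'i \<Rightarrow> 'a \<Rightarrow> real" +
  assumes scale_mult_left: "smul c x * y = smul c (x * y)"
    and scale_mult_right: "x * smul c y = smul c (x * y)"
    and strong: "\<alpha> \<in> I \<Longrightarrow> \<exists>h\<in>I. \<forall>\<beta>\<in>I. X h \<subseteq> X \<beta> \<longrightarrow>
      (\<exists>C>0. \<forall>a\<in>X \<alpha>. \<forall>b\<in>X \<beta>.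
         a * b \<in> X \<beta> \<and> nrm \<beta> (a * b) \<le> C * nrm \<alpha> a * nrm \<beta> b \<and>
         b * a \<in> X \<beta> \<and> nrm \<beta> (b * a) \<le> C * nrm \<alpha> a * nrm \<beta> b)"

text \<open>
  The sort \<open>{ring, monoid_mult}\<close> is that of unital rings without the requirement \<open>0 \<noteq> 1\<close> of
  \<^class>\<open>ring_1\<close>.
\<close>

locale unital_strong_algebra = strong_algebra smul I X nrm
  for smul :: "complex \<Rightarrow> 'a::{ring, monoid_mult} \<Rightarrow> 'a"
    and I :: "'i set" and X :: "'i \<Rightarrow> 'a set" and nrm :: "'i \<Rightarrow> 'a \<Rightarrow> real"

text \<open>
  For a Banach space \<open>(V, N)\<close>, the functions \<open>t \<mapsto> \<Sum>n\<in>\<int>. a\<^sub>n e\<^bsup>int\<^esup>\<close> with \<open>a\<^sub>n \<in> V\<close> and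
  \<open>\<Sum>n\<in>\<int>. N a\<^sub>n < \<infinity>\<close>, the series converging in the norm \<open>N\<close>.  A function on \<open>[-\<pi>, \<pi>)\<close> is represented by
  its \<open>2\<pi>\<close>-periodic extension to the real line; periodicity follows from the series expansion.
\<close>

definition wiener_space ::
  "(complex \<Rightarrow> 'a::ab_group_add \<Rightarrow> 'a) \<Rightarrow> 'a set \<Rightarrow> ('a \<Rightarrow> real) \<Rightarrow> (real \<Rightarrow> 'a) set" where
  "wiener_space smul V N =
    {a. \<exists>c :: int \<Rightarrow> 'a. (\<forall>n. c n \<in> V) \<and> (\<lambda>n. N (c n)) summable_on UNIV \<and>
      (\<forall>t. limitin (norm_topology V N)
             (\<lambda>F. \<Sum>n\<in>F. smul (cis (of_int n * t)) (c n)) (a t) (finite_subsets_at_top UNIV))}"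

definition wiener_algebra ::
  "(complex \<Rightarrow> 'a::ab_group_add \<Rightarrow> 'a) \<Rightarrow> 'i set \<Rightarrow> ('i \<Rightarrow> 'a set) \<Rightarrow> ('i \<Rightarrow> 'a \<Rightarrow> real) \<Rightarrow>
    (real \<Rightarrow> 'a) set" where
  "wiener_algebra smul I X nrm = (\<Union>\<alpha>\<in>I. wiener_space smul (X \<alpha>) (nrm \<alpha>))"

text \<open>
  For functions, \<open>*\<close> and \<open>1\<close> are the pointwise ones of \<^theory>\<open>HOL-Library.Function_Algebras\<close>.
\<close>

definition invertible_in :: "'b::monoid_mult set \<Rightarrow> 'b \<Rightarrow> bool" where
  "invertible_in S a \<longleftrightarrow> a \<in> S \<and> (\<exists>b\<in>S. a * b = 1 \<and> b * a = 1)"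

end

theory Submission
  imports Defs
begin

text \<open>
  If \<open>a\<close> has an inverse in \<open>\<U>\<close>, evaluating at \<open>t\<close> gives an inverse of \<open>a t\<close>.  The
  converse is Wiener's lemma with values in a non-commutative algebra that is not normed, and it is
  proved by localisation.

  Fix \<open>t0\<close> and a right inverse \<open>b\<close> of \<open>a t0\<close>.  Write \<open>a b = 1 + (a - a t0) b\<close>.  Multiplying \<open>a - a t0\<close> by a
  scalar trapezoidal cut-off of width \<open>w\<close> around \<open>t0\<close> makes its Wiener norm as small as desired (lemma
  \<open>cutoff_increment_small\<close>).  The strong inequality makes multiplication by an element of \<open>Y\<^sub>\<delta>\<close> a bounded operator on
  \<open>Y\<^sub>\<gamma>\<close> for all large \<open>\<gamma>\<close>; hence a small perturbation of \<open>1\<close> has a right inverse by a Neumann series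
  (\<open>neumann_inverse\<close>).  The outcome (\<open>local_right_inverse\<close>) is a scalar Wiener function \<open>\<phi>\<close>, equal to \<open>1\<close> near
  \<open>t0\<close>, and some \<open>g\<close> in \<open>\<U>\<close> with \<open>a g = \<phi>\<close>.  By compactness finitely many such \<open>\<phi>\<close> cover a period, and they combine to
  the constant \<open>1\<close> (\<open>global_right_inverse\<close>); directedness of the index set keeps everything in \<open>\<U>\<close>.
  The right inverse so obtained is two-sided because each \<open>a t\<close> is invertible.

  The analytic input is a family of compactly supported scalar functions with explicit absolutely
  summable Fourier coefficients.  These are triangular functions, obtained as second differences of
  \<open>\<Sum>k\<ge>1. cos (k x) / k\<^sup>2\<close>, which is a quadratic polynomial on a period.
  Two elementary bounds on the coefficients show that the coefficient sequences vary slowly in \<open>\<ell>\<^sup>1\<close> as the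
  width shrinks, and that is the smallness used above.
\<close>

section \<open>Series in a normed subspace\<close>

text \<open>
  Unconditional convergence of a family in the norm \<open>N\<close> on \<open>V\<close>.  Since \<open>N\<close> is a norm on a subset of a bare
  group, the summation theory for topological type classes does not apply; this is its relativised version.
\<close>

definition sums_in :: "'a::ab_group_add set \<Rightarrow> ('a \<Rightarrow> real) \<Rightarrow> ('j \<Rightarrow> 'a) \<Rightarrow> 'a \<Rightarrow> bool" where
  "sums_in V N c s \<longleftrightarrow> (\<forall>n. c n \<in> V) \<and> s \<in> V \<and>
     ((\<lambda>F. N (sum c F - s)) \<longlongrightarrow> 0) (finite_subsets_at_top UNIV)"

lemma sums_in_mem:
  assumes "sums_in V N c s"
  shows "c n \<in> V" "s \<in> V"
  using assms by (auto simp: sums_in_def)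

context complex_normed_subspace
begin

lemma zero_mem [simp]: "0 \<in> V"
  and add_mem: "x \<in> V \<Longrightarrow> y \<in> V \<Longrightarrow> x + y \<in> V"
  and diff_mem: "x \<in> V \<Longrightarrow> y \<in> V \<Longrightarrow> x - y \<in> V"
  and minus_mem: "x \<in> V \<Longrightarrow> - x \<in> V"
  and smul_mem: "x \<in> V \<Longrightarrow> smul z x \<in> V"
  using subspace by (auto simp: subspace_0 subspace_add subspace_diff subspace_neg subspace_scale)

lemma sum_mem: "(\<And>n. n \<in> F \<Longrightarrow> c n \<in> V) \<Longrightarrow> sum c F \<in> V"
  using subspace_sum[OF subspace] .

lemma norm_zero [simp]: "N 0 = 0"
  using norm_eq_0[of 0] by simp

lemma norm_sum_le:
  assumes "\<And>n. n \<in> F \<Longrightarrow> c n \<in> V"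
  shows "N (sum c F) \<le> (\<Sum>n\<in>F. N (c n))"
  using assms
proof (induction F rule: infinite_finite_induct)
  case (insert x F)
  have "N (c x + sum c F) \<le> N (c x) + N (sum c F)"
    using insert by (intro norm_triangle sum_mem) auto
  with insert show ?case by fastforce
qed auto

lemma norm_diff_le: "x \<in> V \<Longrightarrow> y \<in> V \<Longrightarrow> N (x - y) \<le> N x + N y"
  using norm_triangle[of x "- y"] norm_minus[of y] minus_mem[of y] by simp

lemma norm_diff_commute: "x \<in> V \<Longrightarrow> y \<in> V \<Longrightarrow> N (x - y) = N (y - x)"
  using norm_minus[of "x - y"] diff_mem[of x y] by simp

lemma norm_diff_triangle: "x \<in> V \<Longrightarrow> y \<in> V \<Longrightarrow> z \<in> V \<Longrightarrow> N (x - z) \<le> N (x - y) + N (y - z)"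
  using norm_triangle[of "x - y" "y - z"] diff_mem by simp

lemma limitin_norm_topology_iff:
  assumes "\<And>x. f x \<in> V"
  shows "limitin (norm_topology V N) f s G \<longleftrightarrow> s \<in> V \<and> ((\<lambda>x. N (f x - s)) \<longlongrightarrow> 0) G"
proof -
  interpret Metric_space V "norm_dist V N" by (rule Metric_space_norm_dist)
  have "norm_dist V N (f x) s = \<bar>N (f x - s)\<bar>" if "s \<in> V" for x
    using that assms norm_nonneg[OF diff_mem[of "f x" s]] by (simp add: norm_dist_def)
  then show ?thesis
    by (auto simp: norm_topology_def limitin_metric assms tendsto_iff dist_real_def)
qed

lemma sums_in_iff_limitin:
  assumes "\<And>n. c n \<in> V"
  shows "sums_in V N c s \<longleftrightarrow> limitin (norm_topology V N) (sum c) s (finite_subsets_at_top UNIV)"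
  using assms by (simp add: limitin_norm_topology_iff sum_mem sums_in_def)

lemma sums_in_unique:
  assumes "sums_in V N c s" "sums_in V N c s'"
  shows "s = s'"
proof -
  have V: "s \<in> V" "s' \<in> V" "\<And>F. sum c F \<in> V"
    using assms by (auto simp: sums_in_def sum_mem)
  have "((\<lambda>F. N (sum c F - s) + N (sum c F - s')) \<longlongrightarrow> 0) (finite_subsets_at_top UNIV)"
    using assms tendsto_add[of _ 0 _ _ 0] by (fastforce simp: sums_in_def)
  moreover have "N (s - s') \<le> N (sum c F - s) + N (sum c F - s')" for F
    using norm_diff_triangle[of s "sum c F" s'] norm_diff_commute[of s "sum c F"] V by simp
  ultimately have "N (s - s') \<le> 0"
    by (intro tendsto_lowerbound[where F = "finite_subsets_at_top UNIV"]) auto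
  then show ?thesis
    using norm_nonneg[of "s - s'"] norm_eq_0[of "s - s'"] diff_mem V by auto
qed

lemma sums_in_norm_le:
  assumes "sums_in V N c s" and summable: "(\<lambda>n. N (c n)) summable_on UNIV"
  shows "N s \<le> (\<Sum>\<^sub>\<infinity>n. N (c n))"
proof -
  have V: "s \<in> V" "\<And>n. c n \<in> V" "\<And>F. sum c F \<in> V"
    using assms by (auto simp: sums_in_def sum_mem)
  have "N s \<le> N (sum c F - s) + (\<Sum>\<^sub>\<infinity>n. N (c n))" if "finite F" for F
  proof -
    have "N s \<le> N (sum c F) + N (sum c F - s)"
      using norm_diff_le[of "sum c F" "sum c F - s"] V by (simp add: diff_mem)
    moreover have "N (sum c F) \<le> (\<Sum>n\<in>F. N (c n))"
      using V by (intro norm_sum_le) auto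
    moreover have "(\<Sum>n\<in>F. N (c n)) \<le> (\<Sum>\<^sub>\<infinity>n. N (c n))"
      using that V norm_nonneg by (intro finite_sum_le_infsum summable) auto
    ultimately show ?thesis by simp
  qed
  then have "eventually (\<lambda>F. N s \<le> N (sum c F - s) + (\<Sum>\<^sub>\<infinity>n. N (c n))) (finite_subsets_at_top UNIV)"
    by (auto intro!: eventually_finite_subsets_at_top_weakI)
  moreover have "((\<lambda>F. N (sum c F - s) + (\<Sum>\<^sub>\<infinity>n. N (c n))) \<longlongrightarrow> 0 + (\<Sum>\<^sub>\<infinity>n. N (c n)))
      (finite_subsets_at_top UNIV)"
    using assms(1) by (intro tendsto_add) (auto simp: sums_in_def)
  ultimately show ?thesis
    using tendsto_lowerbound[where F = "finite_subsets_at_top UNIV"] by fastforce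
qed

lemma sums_in_diff:
  assumes "sums_in V N c s" "sums_in V N d t"
  shows "sums_in V N (\<lambda>n. c n - d n) (s - t)"
proof -
  have V: "s \<in> V" "t \<in> V" "\<And>n. c n \<in> V" "\<And>n. d n \<in> V" "\<And>F. sum c F \<in> V" "\<And>F. sum d F \<in> V"
    using assms by (auto simp: sums_in_def sum_mem)
  have *: "((\<lambda>F. N (sum c F - s) + N (sum d F - t)) \<longlongrightarrow> 0) (finite_subsets_at_top UNIV)"
    using assms tendsto_add[of _ 0 _ _ 0] by (fastforce simp: sums_in_def)
  have "N ((\<Sum>n\<in>F. c n - d n) - (s - t)) \<le> N (sum c F - s) + N (sum d F - t)" for F
    using norm_diff_le[of "sum c F - s" "sum d F - t"] V
    by (simp add: sum_subtractf diff_mem algebra_simps)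
  then have "((\<lambda>F. N ((\<Sum>n\<in>F. c n - d n) - (s - t))) \<longlongrightarrow> 0) (finite_subsets_at_top UNIV)"
    using V by (intro tendsto_sandwich[OF _ _ tendsto_const *] always_eventually)
      (auto intro!: norm_nonneg diff_mem sum_mem)
  then show ?thesis
    using V by (auto simp: sums_in_def diff_mem)
qed

end

text \<open>
  The identities between Fourier sums below are obtained by pushing a convergent family through a
  bounded additive map and appealing to uniqueness of sums, so that no double series is ever rearranged.
\<close>

lemma sums_in_bounded_linear_image:
  assumes "complex_normed_subspace smul V N" "complex_normed_subspace smul' W M"
    and T: "\<And>x. x \<in> V \<Longrightarrow> T x \<in> W"
    and add: "\<And>x y. x \<in> V \<Longrightarrow> y \<in> V \<Longrightarrow> T (x + y) = T x + T y"
    and bound: "\<And>x. x \<in> V \<Longrightarrow> M (T x) \<le> C * N x"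
    and c: "sums_in V N c s"
  shows "sums_in W M (\<lambda>n. T (c n)) (T s)"
proof -
  interpret V: complex_normed_subspace smul V N by fact
  interpret W: complex_normed_subspace smul' W M by fact
  have mem: "s \<in> V" "\<And>n. c n \<in> V" "\<And>F. sum c F \<in> V"
    using c by (auto simp: sums_in_def V.sum_mem)
  have T0: "T 0 = 0" using add[of 0 0] by simp
  have diff: "T (x - y) = T x - T y" if "x \<in> V" "y \<in> V" for x y
    using add[of "x - y" y] that by (simp add: V.diff_mem)
  have Tsum: "T (sum c F) = (\<Sum>n\<in>F. T (c n))" for F
    by (induction F rule: infinite_finite_induct) (auto simp: T0 add mem)
  have *: "((\<lambda>F. C * N (sum c F - s)) \<longlongrightarrow> 0) (finite_subsets_at_top UNIV)"
    using tendsto_mult_left[of _ 0 _ C] c by (auto simp: sums_in_def)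
  have "M ((\<Sum>n\<in>F. T (c n)) - T s) \<le> C * N (sum c F - s)" for F
    using bound[of "sum c F - s"] mem by (simp add: diff Tsum V.diff_mem)
  then have "((\<lambda>F. M ((\<Sum>n\<in>F. T (c n)) - T s)) \<longlongrightarrow> 0) (finite_subsets_at_top UNIV)"
    using mem T by (intro tendsto_sandwich[OF _ _ tendsto_const *] always_eventually)
      (auto intro!: W.norm_nonneg W.diff_mem W.sum_mem)
  then show ?thesis
    using mem T by (auto simp: sums_in_def)
qed

context complex_normed_subspace
begin

lemma sums_in_smul:
  assumes "sums_in V N c s"
  shows "sums_in V N (\<lambda>n. smul z (c n)) (smul z s)"
  by (rule sums_in_bounded_linear_image[OF complex_normed_subspace_axioms
        complex_normed_subspace_axioms _ _ _ assms, where C = "cmod z"])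
    (auto simp: smul_mem scale_right_distrib norm_scale)

lemma MCauchy_iff:
  "Metric_space.MCauchy V (norm_dist V N) \<sigma> \<longleftrightarrow>
     range \<sigma> \<subseteq> V \<and> (\<forall>\<epsilon>>0. \<exists>M. \<forall>m\<ge>M. \<forall>n\<ge>M. N (\<sigma> m - \<sigma> n) < \<epsilon>)"
proof -
  interpret Metric_space V "norm_dist V N" by (rule Metric_space_norm_dist)
  have "range \<sigma> \<subseteq> V \<Longrightarrow> norm_dist V N (\<sigma> m) (\<sigma> n) = N (\<sigma> m - \<sigma> n)" for m n
    by (auto simp: norm_dist_def)
  then show ?thesis
    unfolding MCauchy_def by (auto simp: Ball_def)
qed

lemma mcomplete_iff:
  "Metric_space.mcomplete V (norm_dist V N) \<longleftrightarrow>
     (\<forall>\<sigma>. range \<sigma> \<subseteq> V \<longrightarrow> (\<forall>\<epsilon>>0. \<exists>M. \<forall>m\<ge>M. \<forall>n\<ge>M. N (\<sigma> m - \<sigma> n) < \<epsilon>) \<longrightarrow>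
        (\<exists>s\<in>V. (\<lambda>n. N (\<sigma> n - s)) \<longlonglongrightarrow> 0))"
proof -
  interpret Metric_space V "norm_dist V N" by (rule Metric_space_norm_dist)
  have lim: "limitin mtopology \<sigma> s sequentially \<longleftrightarrow> s \<in> V \<and> (\<lambda>n. N (\<sigma> n - s)) \<longlonglongrightarrow> 0"
    if "range \<sigma> \<subseteq> V" for \<sigma> s
    unfolding norm_topology_def[symmetric] using that by (intro limitin_norm_topology_iff) auto
  have "(\<exists>s. limitin mtopology \<sigma> s sequentially) \<longleftrightarrow> (\<exists>s\<in>V. (\<lambda>n. N (\<sigma> n - s)) \<longlonglongrightarrow> 0)"
    if "range \<sigma> \<subseteq> V" for \<sigma>
    by (auto simp: lim[OF that])
  then show ?thesis
    unfolding mcomplete_def MCauchy_iff by (simp add: imp_conjL cong: imp_cong)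
qed

end

context complex_banach_subspace
begin

lemma Cauchy_convergent:
  assumes "\<And>n. \<sigma> n \<in> V" "\<And>\<epsilon>. \<epsilon> > 0 \<Longrightarrow> \<exists>M. \<forall>m\<ge>M. \<forall>n\<ge>M. N (\<sigma> m - \<sigma> n) < \<epsilon>"
  obtains s where "s \<in> V" "(\<lambda>n. N (\<sigma> n - s)) \<longlonglongrightarrow> 0"
proof -
  have "range \<sigma> \<subseteq> V" using assms(1) by blast
  then show ?thesis
    using complete[unfolded mcomplete_iff, rule_format, of \<sigma>] assms(2) that by blast
qed

text \<open>
  Completeness speaks about sequences while the sum is a limit over the net of finite index sets.
  Finite sets \<open>T \<epsilon>\<close> whose complement carries mass less than \<open>\<epsilon>\<close> supply a Cauchy sequence of partial sums,
  and the same tail estimate shows that the whole net follows its limit.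
\<close>

lemma absolutely_summable_imp_sums_in:
  assumes c: "\<And>n. c n \<in> V" and summable: "(\<lambda>n. N (c n)) summable_on UNIV"
  obtains s where "sums_in V N c s"
proof -
  define S where "S = (\<Sum>\<^sub>\<infinity>n. N (c n))"
  have "\<exists>F. finite F \<and> (\<forall>G. finite G \<longrightarrow> G \<inter> F = {} \<longrightarrow> (\<Sum>n\<in>G. N (c n)) < \<epsilon>)" if "\<epsilon> > 0" for \<epsilon>
  proof -
    have lim: "((\<lambda>F. \<Sum>n\<in>F. N (c n)) \<longlongrightarrow> S) (finite_subsets_at_top UNIV)"
      using summable by (simp add: S_def has_sum_infsum flip: has_sum_def)
    have "S - \<epsilon> < S" using that by simp
    from order_tendstoD(1)[OF lim this]
    obtain F where F: "finite F" "S - \<epsilon> < (\<Sum>n\<in>F. N (c n))"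
      unfolding eventually_finite_subsets_at_top by auto
    have "(\<Sum>n\<in>G. N (c n)) < \<epsilon>" if "finite G" "G \<inter> F = {}" for G
    proof -
      have "(\<Sum>n\<in>G \<union> F. N (c n)) \<le> S"
        unfolding S_def using that F c norm_nonneg by (intro finite_sum_le_infsum summable) auto
      with that F show ?thesis by (simp add: sum.union_disjoint)
    qed
    with F show ?thesis by blast
  qed
  then obtain T where T: "\<And>\<epsilon>. \<epsilon> > 0 \<Longrightarrow> finite (T \<epsilon>)"
      "\<And>\<epsilon> G. \<epsilon> > 0 \<Longrightarrow> finite G \<Longrightarrow> G \<inter> T \<epsilon> = {} \<Longrightarrow> (\<Sum>n\<in>G. N (c n)) < \<epsilon>"
    by metis
  \<comment> \<open>Unions make the index sets increase, so one tail estimate compares all later partial sums.\<close>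
  define \<sigma> where "\<sigma> k = sum c (\<Union>j\<le>k. T (inverse (real (Suc j))))" for k
  have tail: "N (sum c G - \<sigma> k) < inverse (real (Suc m))"
    if "finite G" "m \<le> k" "(\<Union>j\<le>k. T (inverse (real (Suc j)))) \<subseteq> G" for G m k
  proof -
    define F where "F = (\<Union>j\<le>k. T (inverse (real (Suc j))))"
    have "sum c G - \<sigma> k = sum c (G - F)"
      using that by (simp add: sum_diff F_def \<sigma>_def)
    also have "N \<dots> \<le> (\<Sum>n\<in>G - F. N (c n))"
      using c by (intro norm_sum_le) auto
    also have "\<dots> < inverse (real (Suc m))"
      using that F_def by (intro T) auto
    finally show ?thesis .
  qed
  have \<sigma>V: "\<sigma> k \<in> V" for k
    using c by (auto simp: \<sigma>_def intro!: sum_mem)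
  have cauchy: "N (\<sigma> m - \<sigma> k) < inverse (real (Suc M))" if "M \<le> m" "M \<le> k" for m k M
  proof -
    have "N (\<sigma> m - \<sigma> k) < inverse (real (Suc M))" if "M \<le> k" "k \<le> m" for m k
      unfolding \<sigma>_def[of m] using T that by (intro tail) force+
    from this[of k m] this[of m k] show ?thesis
      using norm_diff_commute[of "\<sigma> m" "\<sigma> k"] \<sigma>V that by (cases "k \<le> m") auto
  qed
  obtain s where s: "s \<in> V" "(\<lambda>k. N (\<sigma> k - s)) \<longlonglongrightarrow> 0"
  proof (rule Cauchy_convergent[of \<sigma>, OF \<sigma>V])
    fix \<epsilon> :: real assume "\<epsilon> > 0"
    then obtain M where "inverse (real (Suc M)) < \<epsilon>"
      using reals_Archimedean by blast
    then show "\<exists>M. \<forall>m\<ge>M. \<forall>n\<ge>M. N (\<sigma> m - \<sigma> n) < \<epsilon>"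
      using cauchy less_trans by blast
  qed auto
  have "((\<lambda>F. N (sum c F - s)) \<longlongrightarrow> 0) (finite_subsets_at_top UNIV)"
  proof (rule tendstoI)
    fix \<epsilon> :: real assume \<epsilon>: "\<epsilon> > 0"
    then obtain M where M: "inverse (real (Suc M)) < \<epsilon> / 2"
      using reals_Archimedean[of "\<epsilon> / 2"] by auto
    have "eventually (\<lambda>k. N (\<sigma> k - s) < \<epsilon> / 2) sequentially"
      using \<epsilon> by (intro order_tendstoD(2)[OF s(2)]) simp
    then obtain k where k: "k \<ge> M" "N (\<sigma> k - s) < \<epsilon> / 2"
      by (metis eventually_at_top_linorder nle_le)
    have "dist (N (sum c G - s)) 0 < \<epsilon>"
      if "finite G" "(\<Union>j\<le>k. T (inverse (real (Suc j)))) \<subseteq> G" for G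
    proof -
      have G: "sum c G \<in> V" using c by (intro sum_mem) auto
      have "N (sum c G - s) \<le> N (sum c G - \<sigma> k) + N (\<sigma> k - s)"
        using G \<sigma>V s by (intro norm_diff_triangle) auto
      also have "\<dots> < \<epsilon>" using tail[OF that(1) k(1) that(2)] M k by simp
      finally show ?thesis using norm_nonneg[of "sum c G - s"] G s diff_mem by simp
    qed
    moreover have "finite (\<Union>j\<le>k. T (inverse (real (Suc j))))" using T by force
    ultimately show "eventually (\<lambda>F. dist (N (sum c F - s)) 0 < \<epsilon>) (finite_subsets_at_top UNIV)"
      unfolding eventually_finite_subsets_at_top by blast
  qed
  with that s c show ?thesis by (auto simp: sums_in_def)
qed

end

section \<open>Absolutely convergent Fourier series\<close>

lemma sums_in_reindex:
  assumes "sums_in V N c s" "bij h"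
  shows "sums_in V N (\<lambda>n. c (h n)) s"
proof -
  have inj: "inj h" using assms(2) by (simp add: bij_is_inj)
  have "((\<lambda>F. N (sum c F - s)) \<longlongrightarrow> 0) (filtermap ((`) h) (finite_subsets_at_top UNIV))"
    using assms by (simp add: sums_in_def filtermap_image_finite_subsets_at_top inj bij_is_surj)
  then have "((\<lambda>F. N (sum c (h ` F) - s)) \<longlongrightarrow> 0) (finite_subsets_at_top UNIV)"
    by (simp add: tendsto_def eventually_filtermap)
  moreover have "sum c (h ` F) = (\<Sum>n\<in>F. c (h n))" for F
    using inj by (simp add: sum.reindex inj_on_subset[OF inj])
  ultimately show ?thesis
    using assms by (auto simp: sums_in_def)
qed

text \<open>
  A Wiener function is handled through its coefficients: the norm of the Wiener space is a norm of the coefficient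
  sequence, and \<open>fourier_sum\<close> is a bounded linear map from sequences to values.  Working with
  sequences avoids having to recover the coefficients from the function.
\<close>

definition ell1 :: "'a::ab_group_add set \<Rightarrow> ('a \<Rightarrow> real) \<Rightarrow> (int \<Rightarrow> 'a) set" where
  "ell1 V N = {c. (\<forall>n. c n \<in> V) \<and> (\<lambda>n. N (c n)) summable_on UNIV}"

definition ell1_norm :: "('a \<Rightarrow> real) \<Rightarrow> (int \<Rightarrow> 'a) \<Rightarrow> real" where
  "ell1_norm N c = (\<Sum>\<^sub>\<infinity>n. N (c n))"

definition fourier_sum ::
  "(complex \<Rightarrow> 'a::ab_group_add \<Rightarrow> 'a) \<Rightarrow> 'a set \<Rightarrow> ('a \<Rightarrow> real) \<Rightarrow> (int \<Rightarrow> 'a) \<Rightarrow> real \<Rightarrow> 'a" where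
  "fourier_sum smul V N c t = (THE s. sums_in V N (\<lambda>n. smul (cis (of_int n * t)) (c n)) s)"

context complex_normed_subspace
begin

lemma ell1I:
  assumes "\<And>n. c n \<in> V" "\<And>n. N (c n) \<le> f n" "f summable_on UNIV"
  shows "c \<in> ell1 V N"
  using assms norm_nonneg unfolding ell1_def
  by (auto intro: summable_on_comparison_test[OF assms(3)])

lemma ell1_mem: "c \<in> ell1 V N \<Longrightarrow> c n \<in> V"
  and ell1_summable: "c \<in> ell1 V N \<Longrightarrow> (\<lambda>n. N (c n)) summable_on UNIV"
  by (auto simp: ell1_def)

lemma ell1_norm_le:
  assumes "c \<in> ell1 V N" "\<And>n. N (c n) \<le> f n" "f summable_on UNIV"
  shows "ell1_norm N c \<le> infsum f UNIV"
  unfolding ell1_norm_def using assms by (intro infsum_mono ell1_summable)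

lemma complex_normed_subspace_ell1:
  "complex_normed_subspace (\<lambda>z c n. smul z (c n)) (ell1 V N) (ell1_norm N)"
proof -
  interpret f: vector_space "\<lambda>z (c :: int \<Rightarrow> 'a) n. smul z (c n)"
    by unfold_locales (auto simp: fun_eq_iff scale_right_distrib scale_left_distrib)
  have add: "(\<lambda>n. c n + d n) \<in> ell1 V N" if "c \<in> ell1 V N" "d \<in> ell1 V N" for c d
    by (rule ell1I[OF _ _ summable_on_add[OF that[THEN ell1_summable]]])
      (use that in \<open>auto intro!: add_mem norm_triangle simp: ell1_mem\<close>)
  show ?thesis
  proof
    show "f.subspace (ell1 V N)"
    proof (rule f.subspaceI)
      show "0 \<in> ell1 V N" by (simp add: ell1_def)
      show "c + d \<in> ell1 V N" if "c \<in> ell1 V N" "d \<in> ell1 V N" for c d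
        using add[OF that] by (simp add: plus_fun_def)
      show "(\<lambda>n. smul z (c n)) \<in> ell1 V N" if "c \<in> ell1 V N" for c z
        by (rule ell1I[OF _ _ summable_on_cmult_right[OF ell1_summable[OF that], of "cmod z"]])
          (use that in \<open>auto simp: ell1_mem smul_mem norm_scale\<close>)
    qed
    show "ell1_norm N c = 0 \<longleftrightarrow> c = 0" if c: "c \<in> ell1 V N" for c
    proof
      assume z: "ell1_norm N c = 0"
      have "N (c n) = 0" for n
        using z c norm_nonneg by (intro nonneg_infsum_le_0D[of "\<lambda>n. N (c n)"]) (auto simp: ell1_norm_def ell1_def)
      then show "c = 0" using c norm_eq_0 by (auto simp: ell1_def fun_eq_iff)
    qed (simp add: ell1_norm_def)
    show "ell1_norm N (\<lambda>n. smul z (c n)) = cmod z * ell1_norm N c" if "c \<in> ell1 V N" for c z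
      using that by (simp add: ell1_norm_def norm_scale ell1_mem infsum_cmult_right')
    show "ell1_norm N (c + d) \<le> ell1_norm N c + ell1_norm N d" if "c \<in> ell1 V N" "d \<in> ell1 V N" for c d
    proof -
      have "ell1_norm N (\<lambda>n. c n + d n) \<le> (\<Sum>\<^sub>\<infinity>n. N (c n) + N (d n))"
        using that by (intro ell1_norm_le add norm_triangle summable_on_add ell1_summable ell1_mem)
      also have "\<dots> = ell1_norm N c + ell1_norm N d"
        unfolding ell1_norm_def using that by (intro infsum_add ell1_summable)
      finally show ?thesis by (simp add: plus_fun_def)
    qed
  qed
qed

lemma norm_le_ell1_norm: "c \<in> ell1 V N \<Longrightarrow> N (c n) \<le> ell1_norm N c"
  using finite_sum_le_infsum[OF ell1_summable, of c "{n}"] norm_nonneg ell1_mem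
  by (simp add: ell1_norm_def)

lemma sum_le_ell1_norm: "c \<in> ell1 V N \<Longrightarrow> finite F \<Longrightarrow> (\<Sum>n\<in>F. N (c n)) \<le> ell1_norm N c"
  unfolding ell1_norm_def using norm_nonneg ell1_mem
  by (intro finite_sum_le_infsum ell1_summable) auto

end

context complex_banach_subspace
begin

text \<open>
  The usual proof: a Cauchy sequence of sequences converges coordinatewise, and the Cauchy estimate survives in
  the limit on every finite set of coordinates.
\<close>

lemma complex_banach_subspace_ell1:
  "complex_banach_subspace (\<lambda>z c n. smul z (c n)) (ell1 V N) (ell1_norm N)"
proof -
  interpret L: complex_normed_subspace "\<lambda>z c n. smul z (c n)" "ell1 V N" "ell1_norm N"
    by (rule complex_normed_subspace_ell1)
  have "\<exists>s\<in>ell1 V N. (\<lambda>m. ell1_norm N (\<sigma> m - s)) \<longlonglongrightarrow> 0"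
    if \<sigma>: "range \<sigma> \<subseteq> ell1 V N"
      and cauchy: "\<forall>\<epsilon>>0. \<exists>M. \<forall>m\<ge>M. \<forall>n\<ge>M. ell1_norm N (\<sigma> m - \<sigma> n) < \<epsilon>" for \<sigma>
  proof -
    have mem: "\<sigma> m \<in> ell1 V N" "\<sigma> m k \<in> V" for m k using \<sigma> by (auto simp: ell1_def)
    have "\<exists>s\<in>V. (\<lambda>m. N (\<sigma> m k - s)) \<longlonglongrightarrow> 0" for k
    proof (rule Cauchy_convergent[of "\<lambda>m. \<sigma> m k"])
      show "\<exists>M. \<forall>m\<ge>M. \<forall>n\<ge>M. N (\<sigma> m k - \<sigma> n k) < \<epsilon>" if "\<epsilon> > 0" for \<epsilon>
      proof -
        from cauchy that obtain M where M: "\<And>m n. m \<ge> M \<Longrightarrow> n \<ge> M \<Longrightarrow> ell1_norm N (\<sigma> m - \<sigma> n) < \<epsilon>" by metis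
        have "N (\<sigma> m k - \<sigma> n k) < \<epsilon>" if "m \<ge> M" "n \<ge> M" for m n
          using norm_le_ell1_norm[OF L.diff_mem[OF mem(1) mem(1)], of m n k] M[OF that] by simp
        then show ?thesis by blast
      qed
    qed (use mem in auto)
    then obtain s where s: "\<And>k. s k \<in> V" "\<And>k. (\<lambda>m. N (\<sigma> m k - s k)) \<longlonglongrightarrow> 0" by metis
    have partial: "(\<Sum>k\<in>F. N (\<sigma> m k - s k)) \<le> \<epsilon>"
      if F: "finite F" and M: "\<forall>n\<ge>M. ell1_norm N (\<sigma> m - \<sigma> n) < \<epsilon>" for F m M \<epsilon>
    proof (rule tendsto_lowerbound)
      show "(\<lambda>n. \<epsilon> + (\<Sum>k\<in>F. N (\<sigma> n k - s k))) \<longlonglongrightarrow> \<epsilon>"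
        by (rule tendsto_eq_rhs[OF tendsto_add[OF tendsto_const tendsto_sum[OF s(2)]]]) simp
      have "(\<Sum>k\<in>F. N (\<sigma> m k - s k)) \<le> \<epsilon> + (\<Sum>k\<in>F. N (\<sigma> n k - s k))" if "n \<ge> M" for n
      proof -
        have "(\<Sum>k\<in>F. N (\<sigma> m k - s k)) \<le> (\<Sum>k\<in>F. N ((\<sigma> m - \<sigma> n) k)) + (\<Sum>k\<in>F. N (\<sigma> n k - s k))"
          unfolding sum.distrib[symmetric]
          by (intro sum_mono) (auto intro: norm_diff_triangle mem s)
        moreover have "(\<Sum>k\<in>F. N ((\<sigma> m - \<sigma> n) k)) \<le> \<epsilon>"
          using sum_le_ell1_norm[OF L.diff_mem[OF mem(1) mem(1)] F, of m n] M that by force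
        ultimately show ?thesis by simp
      qed
      then show "eventually (\<lambda>n. (\<Sum>k\<in>F. N (\<sigma> m k - s k)) \<le> \<epsilon> + (\<Sum>k\<in>F. N (\<sigma> n k - s k))) sequentially"
        by (auto simp: eventually_at_top_linorder)
    qed auto
    have diff: "\<sigma> m - s \<in> ell1 V N \<and> ell1_norm N (\<sigma> m - s) \<le> \<epsilon>"
      if M: "\<forall>n\<ge>M. ell1_norm N (\<sigma> m - \<sigma> n) < \<epsilon>" for m M \<epsilon>
    proof -
      have "(\<lambda>k. N ((\<sigma> m - s) k)) summable_on UNIV"
        using mem s partial[OF _ M]
        by (intro nonneg_bdd_above_summable_on bdd_aboveI[of _ \<epsilon>]) (auto intro!: norm_nonneg diff_mem)
      then show ?thesis
        using mem s partial[OF _ M] unfolding ell1_norm_def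
        by (auto simp: ell1_def diff_mem intro!: infsum_le_finite_sums)
    qed
    obtain M where M: "\<And>m n. m \<ge> M \<Longrightarrow> n \<ge> M \<Longrightarrow> ell1_norm N (\<sigma> m - \<sigma> n) < 1"
      using cauchy zero_less_one by blast
    then have "\<sigma> M - s \<in> ell1 V N" using diff[of M M 1] by blast
    from L.diff_mem[OF mem(1)[of M] this] have s_mem: "s \<in> ell1 V N" by simp
    have "(\<lambda>m. ell1_norm N (\<sigma> m - s)) \<longlonglongrightarrow> 0"
    proof (rule LIMSEQ_I)
      fix \<epsilon> :: real assume "\<epsilon> > 0"
      then obtain M where M: "\<And>m n. m \<ge> M \<Longrightarrow> n \<ge> M \<Longrightarrow> ell1_norm N (\<sigma> m - \<sigma> n) < \<epsilon> / 2"
        using cauchy by (meson half_gt_zero)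
      have "norm (ell1_norm N (\<sigma> m - s) - 0) < \<epsilon>" if "m \<ge> M" for m
      proof -
        have "ell1_norm N (\<sigma> m - s) \<le> \<epsilon> / 2" using diff[of M m "\<epsilon> / 2"] M that by blast
        moreover have "0 \<le> ell1_norm N (\<sigma> m - s)" by (intro L.norm_nonneg L.diff_mem mem s_mem)
        ultimately show ?thesis using \<open>\<epsilon> > 0\<close> by simp
      qed
      then show "\<exists>M. \<forall>m\<ge>M. norm (ell1_norm N (\<sigma> m - s) - 0) < \<epsilon>" by blast
    qed
    with s_mem show ?thesis by blast
  qed
  then show ?thesis
    by unfold_locales (auto simp: L.mcomplete_iff)
qed

lemma fourier_sum_eqI:
  assumes "sums_in V N (\<lambda>n. smul (cis (of_int n * t)) (c n)) s"
  shows "fourier_sum smul V N c t = s"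
  unfolding fourier_sum_def using assms sums_in_unique by blast

lemma sums_in_fourier_sum:
  assumes "c \<in> ell1 V N"
  shows "sums_in V N (\<lambda>n. smul (cis (of_int n * t)) (c n)) (fourier_sum smul V N c t)"
proof -
  obtain s where "sums_in V N (\<lambda>n. smul (cis (of_int n * t)) (c n)) s"
    by (rule absolutely_summable_imp_sums_in)
      (use assms in \<open>auto simp: ell1_mem smul_mem norm_scale ell1_summable\<close>)
  with fourier_sum_eqI show ?thesis by metis
qed

lemma fourier_sum_mem: "c \<in> ell1 V N \<Longrightarrow> fourier_sum smul V N c t \<in> V"
  using sums_in_mem(2)[OF sums_in_fourier_sum] .

lemma fourier_sum_diff:
  assumes "c \<in> ell1 V N" "d \<in> ell1 V N"
  shows "fourier_sum smul V N (c - d) t = fourier_sum smul V N c t - fourier_sum smul V N d t"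
  using sums_in_diff[OF sums_in_fourier_sum sums_in_fourier_sum, OF assms, of t t]
  by (intro fourier_sum_eqI) (simp add: scale_right_diff_distrib)

lemma fourier_sum_add:
  assumes "c \<in> ell1 V N" "d \<in> ell1 V N"
  shows "fourier_sum smul V N (c + d) t = fourier_sum smul V N c t + fourier_sum smul V N d t"
proof -
  interpret L: complex_normed_subspace "\<lambda>z c n. smul z (c n)" "ell1 V N" "ell1_norm N"
    by (rule complex_normed_subspace_ell1)
  show ?thesis using fourier_sum_diff[OF L.add_mem[OF assms] assms(2), of t] by simp
qed

lemma norm_fourier_sum_le:
  assumes "c \<in> ell1 V N"
  shows "N (fourier_sum smul V N c t) \<le> ell1_norm N c"
  using sums_in_norm_le[OF sums_in_fourier_sum[OF assms, of t]] assms
  by (simp add: norm_scale ell1_mem ell1_summable ell1_norm_def)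

lemma fourier_sum_periodic: "fourier_sum smul V N c (t + 2 * pi * of_int j) = fourier_sum smul V N c t"
proof -
  have "cis (of_int n * (t + 2 * pi * of_int j)) = cis (of_int n * t)" for n
    using cis_multiple_2pi[of "of_int (n * j)"] by (simp add: distrib_left mult_ac flip: cis_mult)
  then show ?thesis by (simp add: fourier_sum_def)
qed

lemma wiener_space_eq: "wiener_space smul V N = fourier_sum smul V N ` ell1 V N"
proof -
  have "f \<in> wiener_space smul V N \<longleftrightarrow> (\<exists>c\<in>ell1 V N. \<forall>t. sums_in V N (\<lambda>n. smul (cis (of_int n * t)) (c n)) (f t))" for f
    unfolding wiener_space_def ell1_def by (auto simp: sums_in_iff_limitin smul_mem)
  also have "\<dots> f \<longleftrightarrow> f \<in> fourier_sum smul V N ` ell1 V N" for f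
    using fourier_sum_eqI sums_in_fourier_sum by (auto simp: image_iff fun_eq_iff) metis+
  finally show ?thesis by blast
qed

text \<open>
  Absolutely convergent series of Wiener functions may be summed pointwise.  This is how products, cut-off
  increments and Neumann series are constructed.
\<close>

lemma fourier_sum_series:
  assumes "\<And>n. Z n \<in> ell1 V N" "(\<lambda>n. ell1_norm N (Z n)) summable_on UNIV"
  obtains z where "z \<in> ell1 V N" "ell1_norm N z \<le> (\<Sum>\<^sub>\<infinity>n. ell1_norm N (Z n))"
    "\<And>t. sums_in V N (\<lambda>n. fourier_sum smul V N (Z n) t) (fourier_sum smul V N z t)"
proof -
  interpret L: complex_banach_subspace "\<lambda>z c n. smul z (c n)" "ell1 V N" "ell1_norm N"
    by (rule complex_banach_subspace_ell1)
  obtain z where z: "sums_in (ell1 V N) (ell1_norm N) Z z"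
    using L.absolutely_summable_imp_sums_in[of Z] assms by blast
  have "sums_in V N (\<lambda>n. fourier_sum smul V N (Z n) t) (fourier_sum smul V N z t)" for t
    by (rule sums_in_bounded_linear_image[OF L.complex_normed_subspace_axioms
          complex_normed_subspace_axioms _ _ _ z, where C = 1])
      (auto simp: fourier_sum_mem fourier_sum_add[unfolded plus_fun_def] norm_fourier_sum_le)
  with that z show ?thesis
    using L.sums_in_norm_le[OF z assms(2)] sums_in_mem(2)[OF z] by blast
qed

lemma ell1_shift:
  assumes "c \<in> ell1 V N"
  shows "(\<lambda>k. c (k - n)) \<in> ell1 V N"
    "ell1_norm N (\<lambda>k. c (k - n)) = ell1_norm N c"
    "fourier_sum smul V N (\<lambda>k. c (k - n)) t = smul (cis (of_int n * t)) (fourier_sum smul V N c t)"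
proof -
  have bij: "bij (\<lambda>k::int. k - n)" by (rule bij_betwI[of _ _ _ "\<lambda>k. k + n"]) auto
  show "(\<lambda>k. c (k - n)) \<in> ell1 V N"
    using assms summable_on_reindex_bij_betw[OF bij, of "\<lambda>n. N (c n)"] by (simp add: ell1_def)
  show "ell1_norm N (\<lambda>k. c (k - n)) = ell1_norm N c"
    unfolding ell1_norm_def by (rule infsum_reindex_bij_betw[OF bij])
  have "sums_in V N (\<lambda>k. smul (cis (of_int n * t)) (smul (cis (of_int (k - n) * t)) (c (k - n))))
      (smul (cis (of_int n * t)) (fourier_sum smul V N c t))"
    by (intro sums_in_smul sums_in_reindex[OF sums_in_fourier_sum[OF assms] bij])
  then show "fourier_sum smul V N (\<lambda>k. c (k - n)) t = smul (cis (of_int n * t)) (fourier_sum smul V N c t)"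
    by (intro fourier_sum_eqI) (simp add: cis_mult algebra_simps)
qed

end

lemma ell1_bounded_linear_image:
  assumes "complex_banach_subspace smul V N" "complex_banach_subspace smul' W M"
    and T: "\<And>x. x \<in> V \<Longrightarrow> T x \<in> W"
    and add: "\<And>x y. x \<in> V \<Longrightarrow> y \<in> V \<Longrightarrow> T (x + y) = T x + T y"
    and scale: "\<And>x z. x \<in> V \<Longrightarrow> T (smul z x) = smul' z (T x)"
    and bound: "\<And>x. x \<in> V \<Longrightarrow> M (T x) \<le> C * N x"
    and c: "c \<in> ell1 V N"
  shows "(\<lambda>n. T (c n)) \<in> ell1 W M" "ell1_norm M (\<lambda>n. T (c n)) \<le> C * ell1_norm N c"
    "fourier_sum smul' W M (\<lambda>n. T (c n)) t = T (fourier_sum smul V N c t)"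
proof -
  interpret V: complex_banach_subspace smul V N by fact
  interpret W: complex_banach_subspace smul' W M by fact
  have s: "(\<lambda>n. C * N (c n)) summable_on UNIV"
    using c by (intro summable_on_cmult_right V.ell1_summable)
  show Tc: "(\<lambda>n. T (c n)) \<in> ell1 W M"
    by (rule W.ell1I[OF _ _ s]) (use c T bound V.ell1_mem in auto)
  have "ell1_norm M (\<lambda>n. T (c n)) \<le> (\<Sum>\<^sub>\<infinity>n. C * N (c n))"
    by (rule W.ell1_norm_le[OF Tc _ s]) (use c bound V.ell1_mem in auto)
  then show "ell1_norm M (\<lambda>n. T (c n)) \<le> C * ell1_norm N c"
    by (simp add: ell1_norm_def infsum_cmult_right')
  have "sums_in W M (\<lambda>n. T (smul (cis (of_int n * t)) (c n))) (T (fourier_sum smul V N c t))"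
    by (rule sums_in_bounded_linear_image[OF V.complex_normed_subspace_axioms
          W.complex_normed_subspace_axioms T add bound V.sums_in_fourier_sum[OF c]])
  then show "fourier_sum smul' W M (\<lambda>n. T (c n)) t = T (fourier_sum smul V N c t)"
    using c by (intro W.fourier_sum_eqI) (simp add: scale V.ell1_mem)
qed

text \<open>
  A pointwise bilinear product of Wiener functions is a Wiener function.  Its coefficient sequence, the convolution, is
  the absolutely convergent \<open>\<ell>\<^sup>1\<close>-series of the shifts of \<open>d\<close> multiplied by the coefficients of \<open>c\<close>;
  evaluating that series at \<open>t\<close> factors out the value of \<open>d\<close>.
  Besides the product of the algebra, \<open>B\<close> will be scalar multiplication.
\<close>

lemma ell1_convolution:
  assumes "complex_banach_subspace smul1 V1 N1" "complex_banach_subspace smul2 V2 N2"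
    "complex_banach_subspace smul3 V3 N3"
    and mem: "\<And>x y. x \<in> V1 \<Longrightarrow> y \<in> V2 \<Longrightarrow> B x y \<in> V3"
    and add1: "\<And>x x' y. x \<in> V1 \<Longrightarrow> x' \<in> V1 \<Longrightarrow> y \<in> V2 \<Longrightarrow> B (x + x') y = B x y + B x' y"
    and add2: "\<And>x y y'. x \<in> V1 \<Longrightarrow> y \<in> V2 \<Longrightarrow> y' \<in> V2 \<Longrightarrow> B x (y + y') = B x y + B x y'"
    and scale1: "\<And>x y z. x \<in> V1 \<Longrightarrow> y \<in> V2 \<Longrightarrow> B (smul1 z x) y = smul3 z (B x y)"
    and scale2: "\<And>x y z. x \<in> V1 \<Longrightarrow> y \<in> V2 \<Longrightarrow> B x (smul2 z y) = smul3 z (B x y)"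
    and bound: "\<And>x y. x \<in> V1 \<Longrightarrow> y \<in> V2 \<Longrightarrow> N3 (B x y) \<le> C * N1 x * N2 y"
    and c: "c \<in> ell1 V1 N1" and d: "d \<in> ell1 V2 N2"
  obtains e where "e \<in> ell1 V3 N3" "ell1_norm N3 e \<le> C * ell1_norm N1 c * ell1_norm N2 d"
    "\<And>t. fourier_sum smul3 V3 N3 e t = B (fourier_sum smul1 V1 N1 c t) (fourier_sum smul2 V2 N2 d t)"
proof -
  interpret V1: complex_banach_subspace smul1 V1 N1 by fact
  interpret V2: complex_banach_subspace smul2 V2 N2 by fact
  interpret V3: complex_banach_subspace smul3 V3 N3 by fact
  interpret L3: complex_normed_subspace "\<lambda>z c n. smul3 z (c n)" "ell1 V3 N3" "ell1_norm N3"
    by (rule V3.complex_normed_subspace_ell1)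
  define Z where "Z k = (\<lambda>j. B (c k) (d (j - k)))" for k
  note c_mem = V1.ell1_mem[OF c]
  note image = ell1_bounded_linear_image[OF assms(2,3) mem[OF c_mem] add2[OF c_mem] scale2[OF c_mem]
      bound[OF c_mem] V2.ell1_shift(1)[OF d]]
  have Z_mem: "Z k \<in> ell1 V3 N3" for k
    unfolding Z_def by (rule image(1))
  have Z_norm: "ell1_norm N3 (Z k) \<le> C * N1 (c k) * ell1_norm N2 d" for k
    unfolding Z_def using image(2)[of k k] by (simp add: V2.ell1_shift(2)[OF d])
  have Z_sum: "fourier_sum smul3 V3 N3 (Z k) t = B (smul1 (cis (of_int k * t)) (c k)) (fourier_sum smul2 V2 N2 d t)" for k t
    unfolding Z_def using image(3)[of k k t]
    by (simp add: V2.ell1_shift(3)[OF d] scale1 scale2 c_mem V2.fourier_sum_mem[OF d])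
  have s: "(\<lambda>k. C * N1 (c k) * ell1_norm N2 d) summable_on UNIV"
    using c by (intro summable_on_cmult_right summable_on_cmult_left V1.ell1_summable)
  have sZ: "(\<lambda>k. ell1_norm N3 (Z k)) summable_on UNIV"
    by (rule summable_on_comparison_test[OF s]) (use Z_norm L3.norm_nonneg Z_mem in auto)
  obtain e where e: "e \<in> ell1 V3 N3" "ell1_norm N3 e \<le> (\<Sum>\<^sub>\<infinity>k. ell1_norm N3 (Z k))"
    "\<And>t. sums_in V3 N3 (\<lambda>k. fourier_sum smul3 V3 N3 (Z k) t) (fourier_sum smul3 V3 N3 e t)"
    using V3.fourier_sum_series[OF Z_mem sZ] by blast
  have "(\<Sum>\<^sub>\<infinity>k. ell1_norm N3 (Z k)) \<le> (\<Sum>\<^sub>\<infinity>k. C * N1 (c k) * ell1_norm N2 d)"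
    by (intro infsum_mono sZ s Z_norm)
  also have "\<dots> = C * ell1_norm N1 c * ell1_norm N2 d"
    by (simp add: ell1_norm_def infsum_cmult_right' infsum_cmult_left')
  finally have norm: "ell1_norm N3 e \<le> C * ell1_norm N1 c * ell1_norm N2 d" using e(2) by simp
  have "fourier_sum smul3 V3 N3 e t = B (fourier_sum smul1 V1 N1 c t) (fourier_sum smul2 V2 N2 d t)" for t
  proof (rule V3.sums_in_unique[OF e(3)])
    show "sums_in V3 N3 (\<lambda>k. fourier_sum smul3 V3 N3 (Z k) t)
       (B (fourier_sum smul1 V1 N1 c t) (fourier_sum smul2 V2 N2 d t))"
      unfolding Z_sum
      by (rule sums_in_bounded_linear_image[OF V1.complex_normed_subspace_axioms
          V3.complex_normed_subspace_axioms _ _ _ V1.sums_in_fourier_sum[OF c],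
          where C = "C * N2 (fourier_sum smul2 V2 N2 d t)"])
       (use bound in \<open>auto simp: mem add1 V2.fourier_sum_mem[OF d] mult_ac\<close>)
  qed
  with that e norm show ?thesis by blast
qed

lemma complex_banach_subspace_complex: "complex_banach_subspace (*) (UNIV :: complex set) cmod"
proof -
  interpret vector_space "(*) :: complex \<Rightarrow> complex \<Rightarrow> complex"
    by unfold_locales (auto simp: algebra_simps)
  interpret complex_normed_subspace "(*)" "UNIV :: complex set" cmod
    by unfold_locales (auto simp: norm_mult norm_triangle_ineq subspace_UNIV)
  have "\<exists>s. (\<lambda>n. cmod (\<sigma> n - s)) \<longlonglongrightarrow> 0"
    if "\<forall>\<epsilon>>0. \<exists>M. \<forall>m\<ge>M. \<forall>n\<ge>M. cmod (\<sigma> m - \<sigma> n) < \<epsilon>" for \<sigma>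
  proof -
    have "Cauchy \<sigma>" using that by (auto simp: Cauchy_def dist_norm)
    then obtain s where "\<sigma> \<longlonglongrightarrow> s" by (auto simp: Cauchy_convergent_iff convergent_def)
    then show ?thesis by (auto simp: tendsto_norm_zero_iff LIM_zero_iff intro!: exI[of _ s])
  qed
  then show ?thesis
    by unfold_locales (auto simp: mcomplete_iff)
qed

lemma sums_in_complex_iff: "sums_in UNIV cmod c s \<longleftrightarrow> (c has_sum s) UNIV"
  by (simp add: sums_in_def has_sum_def tendsto_norm_zero_iff LIM_zero_iff)

section \<open>The dilogarithm on the unit circle\<close>

lemma Im_Ln_one_minus_cis:
  assumes "0 < x" "x < 2 * pi"
  shows "Im (Ln (1 - cis x)) = (x - pi) / 2"
proof -
  have s: "sin (x / 2) > 0" using assms by (intro sin_gt_zero) auto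
  have *: "cos x = 1 - 2 * (sin (x/2))\<^sup>2" "sin x = 2 * sin (x/2) * cos (x/2)"
    using cos_double_sin[of "x/2"] sin_double[of "x/2"] by simp_all
  have polar: "1 - cis x = of_real (2 * sin (x / 2)) * cis ((x - pi) / 2)"
    by (simp add: complex_eq_iff * cos_diff sin_diff diff_divide_distrib power2_eq_square)
  have "Ln (1 - cis x) = of_real (ln (2 * sin (x / 2))) + \<i> * of_real ((x - pi) / 2)"
    unfolding polar using s assms
    by (subst Ln_times_of_real) (simp_all add: Ln_cis Ln_of_real mult.commute del: of_real_mult)
  then show ?thesis by simp
qed

text \<open>
  The dilogarithm on the closed unit disc; the term for \<open>k = 0\<close> is \<open>1 / 0 = 0\<close>.  On the unit circle its real part is
  \<open>\<Sum>k\<ge>1. cos (k x) / k\<^sup>2\<close>.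
\<close>

definition dilog :: "complex \<Rightarrow> complex" where
  "dilog z = (\<Sum>k. z ^ k / of_nat k ^ 2)"

lemma summable_inverse_squares: "summable (\<lambda>k. 1 / real k ^ 2)"
  using inverse_power_summable[of 2, where 'a = real] by (simp add: inverse_eq_divide)

lemma norm_dilog_term_le: "norm z \<le> 1 \<Longrightarrow> norm (z ^ k / of_nat k ^ 2 :: complex) \<le> 1 / real k ^ 2"
  by (simp add: norm_divide norm_power power_le_one divide_right_mono)

lemma summable_dilog:
  assumes "norm z \<le> 1"
  shows "summable (\<lambda>k. norm (z ^ k / of_nat k ^ 2 :: complex))"
  by (rule summable_comparison_test[OF _ summable_inverse_squares])
    (use norm_dilog_term_le[OF assms] in auto)

lemma continuous_on_dilog: "continuous_on (cball 0 1) dilog"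
proof -
  have "uniform_limit (cball 0 1) (\<lambda>n z. \<Sum>k<n. z ^ k / of_nat k ^ 2 :: complex) dilog sequentially"
    unfolding dilog_def
    by (rule Weierstrass_m_test[OF _ summable_inverse_squares]) (simp add: norm_dilog_term_le del: of_nat_power)
  then show ?thesis
    by (rule uniform_limit_theorem[rotated])
      (auto intro!: always_eventually continuous_intros simp: divide_inverse simp del: of_nat_power)
qed

lemma has_field_derivative_dilog:
  assumes "norm z < 1"
  obtains D where "(dilog has_field_derivative D) (at z)" "D * z = - Ln (1 - z)"
proof
  define c :: "nat \<Rightarrow> complex" where "c k = 1 / of_nat k ^ 2" for k
  have *: "dilog = (\<lambda>z. \<Sum>k. c k * z ^ k)"
    by (simp add: dilog_def fun_eq_iff c_def)
  have summable: "summable (\<lambda>k. c k * z ^ k)" if "norm z < 1" for z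
    using summable_norm_cancel[OF summable_dilog[of z]] that by (simp add: c_def)
  show "(dilog has_field_derivative (\<Sum>k. diffs c k * z ^ k)) (at z)"
    unfolding * using assms by (intro termdiffs_strong'[of 1] summable) auto
  have "diffs c k * z ^ k * z = z ^ Suc k / of_nat (Suc k)" for k
    by (simp add: diffs_def c_def power2_eq_square field_simps del: of_nat_Suc)
  moreover have "(\<lambda>k. z ^ Suc k / of_nat (Suc k)) sums (- Ln (1 - z))"
    using sums_minus[OF Ln_series'[of "-z"]] assms by (subst sums_Suc_iff) simp
  ultimately have s: "(\<lambda>k. diffs c k * z ^ k * z) sums (- Ln (1 - z))" by simp
  have "summable (\<lambda>k. diffs c k * z ^ k)"
    using assms by (intro termdiff_converges[of _ 1] summable) auto
  then have "(\<lambda>k. diffs c k * z ^ k * z) sums ((\<Sum>k. diffs c k * z ^ k) * z)"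
    by (intro sums_mult2 summable_sums)
  with s show "(\<Sum>k. diffs c k * z ^ k) * z = - Ln (1 - z)"
    using sums_unique2 by blast
qed

text \<open>
  On the circle of radius \<open>r < 1\<close> the derivative of the real part of the dilogarithm in the angle \<open>x\<close> is the argument
  of \<open>1 - r cis x\<close>.  As \<open>r\<close> tends to \<open>1\<close> this tends boundedly to \<open>(x - pi) / 2\<close>, so the integrals converge too.
\<close>

lemma Re_dilog_cis_diff:
  assumes "0 < u" "u \<le> v" "v < 2 * pi"
  shows "Re (dilog (cis v)) - Re (dilog (cis u)) = (v - pi)\<^sup>2 / 4 - (u - pi)\<^sup>2 / 4"
proof -
  define r where "r m = real m / real (Suc m)" for m
  have r: "0 \<le> r m" "r m < 1" for m by (auto simp: r_def)
  have r_lim: "r \<longlonglongrightarrow> 1"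
    unfolding r_def by (rule LIMSEQ_n_over_Suc_n)
  define g where "g m x = Im (Ln (1 - of_real (r m) * cis x))" for m x
  have ball: "norm (of_real (r m) * cis x) < 1" for m x
    using r[of m] by (simp add: norm_mult)
  have int: "(g m has_integral Re (dilog (r m * cis v)) - Re (dilog (r m * cis u))) {u..v}" for m
  proof (rule fundamental_theorem_of_calculus[OF assms(2)])
    fix x assume "x \<in> {u..v}"
    obtain D where D: "(dilog has_field_derivative D) (at (r m * cis x))"
        "D * (r m * cis x) = - Ln (1 - r m * cis x)"
      using has_field_derivative_dilog[OF ball] by metis
    have "((\<lambda>x. of_real (r m) * cis x) has_vector_derivative r m * (\<i> * cis x)) (at x)"
      by (auto intro!: derivative_eq_intros simp: has_vector_derivative_def scaleR_conv_of_real algebra_simps)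
    from field_vector_diff_chain_at[OF this D(1)]
    have "((\<lambda>x. dilog (r m * cis x)) has_vector_derivative - \<i> * Ln (1 - r m * cis x)) (at x)"
      using D(2) by (simp add: o_def algebra_simps)
    then have "((\<lambda>x. Re (dilog (r m * cis x))) has_vector_derivative Re (- \<i> * Ln (1 - r m * cis x))) (at x)"
      by (rule bounded_linear.has_vector_derivative[OF bounded_linear_Re])
    then show "((\<lambda>x. Re (dilog (r m * cis x))) has_vector_derivative g m x) (at x within {u..v})"
      by (simp add: g_def has_vector_derivative_at_within)
  qed
  have Re_pos: "Re (1 - z) > 0" if "norm z \<le> 1" "z \<noteq> 1" for z
  proof -
    have "Re z \<noteq> 1 \<or> Im z \<noteq> 0" using that by (auto simp: complex_eq_iff)
    moreover have "(Re z)\<^sup>2 + (Im z)\<^sup>2 \<le> 1"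
      using that(1) by (simp add: cmod_def)
    ultimately show ?thesis
      using complex_Re_le_cmod[of z] that by (smt (verit, ccfv_SIG) minus_complex.simps(1) one_complex.simps(1) power2_eq_1_iff zero_less_power2)
  qed
  have lim: "(\<lambda>m. integral {u..v} (g m)) \<longlonglongrightarrow> integral {u..v} (\<lambda>x. (x - pi) / 2)"
  proof (rule dominated_convergence(2)[where h = "\<lambda>_. pi"])
    show "g m integrable_on {u..v}" for m using int by blast
    show "norm (g m x) \<le> pi" for m x
    proof -
      have "1 - of_real (r m) * cis x \<noteq> 0" using ball[of m x] by auto
      then show ?thesis
        using mpi_less_Im_Ln[of "1 - of_real (r m) * cis x"] Im_Ln_le_pi[of "1 - of_real (r m) * cis x"]
        by (auto simp: g_def)
    qed
    show "(\<lambda>m. g m x) \<longlonglongrightarrow> (x - pi) / 2" if "x \<in> {u..v}" for x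
    proof -
      have x: "0 < x" "x < 2 * pi" using that assms by auto
      have "cis x \<noteq> 1"
      proof
        assume "cis x = 1"
        then have "cos x = 1" by (simp add: complex_eq_iff)
        then show False using x cos_double_sin[of "x/2"] sin_gt_zero[of "x/2"] by simp
      qed
      then have "1 - cis x \<notin> \<real>\<^sub>\<le>\<^sub>0"
        using Re_pos[of "cis x"] by (auto simp: complex_nonpos_Reals_iff)
      then have "(\<lambda>m. Im (Ln (1 - of_real (r m) * cis x))) \<longlonglongrightarrow> Im (Ln (1 - of_real 1 * cis x))"
        by (intro tendsto_intros r_lim) auto
      then show ?thesis using Im_Ln_one_minus_cis[OF x] by (simp add: g_def)
    qed
  qed auto
  have "((\<lambda>x. (x - pi) / 2) has_integral (v - pi)\<^sup>2 / 4 - (u - pi)\<^sup>2 / 4) {u..v}"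
    by (rule fundamental_theorem_of_calculus[OF assms(2)])
      (auto intro!: derivative_eq_intros simp flip: has_real_derivative_iff_has_vector_derivative)
  then have "integral {u..v} (\<lambda>x. (x - pi) / 2) = (v - pi)\<^sup>2 / 4 - (u - pi)\<^sup>2 / 4"
    by (rule integral_unique)
  moreover have dl: "(\<lambda>m. Re (dilog (r m * cis x))) \<longlonglongrightarrow> Re (dilog (cis x))" for x
  proof -
    have "(\<lambda>m. of_real (r m) * cis x) \<longlonglongrightarrow> of_real 1 * cis x" by (intro tendsto_intros r_lim)
    moreover have "of_real (r m) * cis x \<in> cball 0 1" for m using ball[of m x] by simp
    ultimately show ?thesis
      by (intro tendsto_Re continuous_on_tendsto_compose[OF continuous_on_dilog]) auto
  qed
  have "(\<lambda>m. integral {u..v} (g m)) \<longlonglongrightarrow> Re (dilog (cis v)) - Re (dilog (cis u))"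
    using int integral_unique tendsto_diff[OF dl[of v] dl[of u]] by (metis (no_types, lifting) ext)
  ultimately show ?thesis
    using lim LIMSEQ_unique by metis
qed

text \<open>
  The additive constant cancels in second differences, the form in which this function enters the Fourier series below.
\<close>

lemma Re_dilog_cis:
  assumes "\<bar>x\<bar> \<le> 2 * pi"
  shows "Re (dilog (cis x)) = (\<bar>x\<bar> - pi)\<^sup>2 / 4 + Re (dilog (cis pi))"
proof -
  have *: "Re (dilog (cis x)) - (x - pi)\<^sup>2 / 4 = Re (dilog (cis pi))" if "x \<in> {0..2 * pi}" for x
  proof (rule continuous_constant_on_closure[of "{0<..<2 * pi}" "\<lambda>x. Re (dilog (cis x)) - (x - pi)\<^sup>2 / 4"])
    have "continuous_on UNIV (\<lambda>x. dilog (cis x))"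
      by (rule continuous_on_compose2[OF continuous_on_dilog]) (auto intro!: continuous_intros)
    then show "continuous_on (closure {0<..<2 * pi}) (\<lambda>x. Re (dilog (cis x)) - (x - pi)\<^sup>2 / 4)"
      by (auto intro!: continuous_intros intro: continuous_on_subset)
    show "Re (dilog (cis x)) - (x - pi)\<^sup>2 / 4 = Re (dilog (cis pi))" if "x \<in> {0<..<2 * pi}" for x
      using Re_dilog_cis_diff[of x pi] Re_dilog_cis_diff[of pi x] that by (cases "x \<le> pi") auto
    show "x \<in> closure {0<..<2 * pi}" using that by simp
  qed
  have "dilog (cnj z) = cnj (dilog z)" if "norm z \<le> 1" for z
  proof -
    have "(\<lambda>k. cnj (z ^ k / of_nat k ^ 2)) sums cnj (dilog z)"
      unfolding sums_cnj dilog_def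
      by (rule summable_sums[OF summable_norm_cancel[OF summable_dilog[OF that]]])
    then show ?thesis by (simp add: dilog_def sums_iff)
  qed
  from this[of "cis x"] have "Re (dilog (cis \<bar>x\<bar>)) = Re (dilog (cis x))"
    by (auto simp: abs_if cis_cnj)
  with *[of "\<bar>x\<bar>"] assms show ?thesis by simp
qed

section \<open>Fourier series of triangular functions\<close>

text \<open>
  The Fourier coefficients of the triangular function \<open>hat w\<close>, repeated with period \<open>2 * pi\<close>.
\<close>

definition hat_coeff :: "real \<Rightarrow> int \<Rightarrow> real" where
  "hat_coeff w k = (if k = 0 then w / (2 * pi) else (1 - cos (k * w)) / (pi * w * k ^ 2))"

definition hat :: "real \<Rightarrow> real \<Rightarrow> real" where
  "hat w t = max 0 (1 - \<bar>t\<bar> / w)"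

lemma has_sum_int:
  fixes f :: "int \<Rightarrow> 'a::{topological_comm_monoid_add, t2_space}"
  assumes "((\<lambda>n. f (int n)) has_sum a) UNIV" "((\<lambda>n. f (- int n)) has_sum b) (UNIV - {0})"
  shows "(f has_sum (a + b)) UNIV"
proof -
  have "(f has_sum a) (range int)"
    using assms(1) by (subst has_sum_reindex) (auto simp: o_def)
  moreover have "(f has_sum b) ((\<lambda>n. - int n) ` (UNIV - {0}))"
    using assms(2) by (subst has_sum_reindex) (auto simp: o_def inj_on_def)
  ultimately have "(f has_sum (a + b)) (range int \<union> (\<lambda>n. - int n) ` (UNIV - {0}))"
    by (rule has_sum_Un_disjoint) auto
  moreover have "x \<in> range int \<union> (\<lambda>n. - int n) ` (UNIV - {0})" for x
    by (cases x rule: int_cases2) auto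
  ultimately show ?thesis by (metis UNIV_eq_I)
qed

lemma hat_coeff_nonneg: "w > 0 \<Longrightarrow> hat_coeff w k \<ge> 0"
  by (simp add: hat_coeff_def)

text \<open>
  Multiplying a coefficient by \<open>1 - cos (k w)\<close> takes half of a negated second difference of step \<open>w\<close> in the variable \<open>t\<close>.
\<close>

lemma has_sum_hat_positive_frequencies:
  assumes "w > 0"
  shows "((\<lambda>n. of_real (if n = 0 then 0 else hat_coeff w (int n)) * cis (real n * t)) has_sum
     (2 * dilog (cis t) - dilog (cis (t + w)) - dilog (cis (t - w))) / of_real (2 * pi * w)) UNIV"
    (is "(?f has_sum ?s) _")
proof (rule norm_summable_imp_has_sum)
  define d :: "real \<Rightarrow> nat \<Rightarrow> complex" where "d x n = cis x ^ n / of_nat n ^ 2" for x n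
  have d: "d x sums dilog (cis x)" for x
    unfolding d_def dilog_def
    by (rule summable_sums[OF summable_norm_cancel[OF summable_dilog]]) simp
  have f: "?f n = (2 * d t n - d (t + w) n - d (t - w) n) / of_real (2 * pi * w)" for n
  proof (cases "n = 0")
    case False
    have "cis (n * (t + w)) + cis (n * (t - w)) = 2 * of_real (cos (n * w)) * cis (n * t)"
      by (simp add: complex_eq_iff algebra_simps cos_add sin_add cos_diff sin_diff)
    then have "2 * cis (n * t) - cis (n * (t + w)) - cis (n * (t - w)) = 2 * of_real (1 - cos (n * w)) * cis (n * t)"
      by (simp add: algebra_simps)
    moreover have "?f n = 2 * of_real (1 - cos (n * w)) * cis (n * t) / (of_nat n ^ 2 * of_real (2 * pi * w))"
      using False assms by (simp add: hat_coeff_def field_simps)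
    moreover have "(2 * d t n - d (t + w) n - d (t - w) n) =
        (2 * cis (n * t) - cis (n * (t + w)) - cis (n * (t - w))) / of_nat n ^ 2"
      by (simp add: d_def Complex.DeMoivre diff_divide_distrib)
    ultimately show ?thesis by simp
  qed (simp add: d_def)
  show "?f sums ?s"
    unfolding f by (intro sums_divide sums_diff sums_mult d)
  have "summable (\<lambda>n. norm (d x n))" for x
    unfolding d_def by (rule summable_dilog) simp
  then have "summable (\<lambda>n. (2 * norm (d t n) + norm (d (t + w) n) + norm (d (t - w) n)) / (2 * pi * w))"
    by (intro summable_divide summable_add summable_mult)
  then show "summable (\<lambda>n. norm (?f n))"
  proof (rule summable_comparison_test[rotated], intro exI allI impI)
    fix n
    have "norm (2 * d t n - d (t + w) n - d (t - w) n) \<le> 2 * norm (d t n) + norm (d (t + w) n) + norm (d (t - w) n)"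
      by (metis (no_types, lifting) add_right_mono norm_mult norm_numeral norm_triangle_ineq4 order_trans)
    then show "norm (norm (?f n)) \<le> (2 * norm (d t n) + norm (d (t + w) n) + norm (d (t - w) n)) / (2 * pi * w)"
      unfolding f using assms by (simp add: norm_divide divide_right_mono norm_mult)
  qed
qed

text \<open>
  The function \<open>(\<bar>x\<bar> - pi)\<^sup>2 / 4\<close> is quadratic with leading coefficient \<open>1/4\<close> on each side of its kink at \<open>0\<close>.
  Its second differences are therefore constant as long as they do not straddle the kink, and linear in \<open>\<bar>t\<bar>\<close> otherwise.
\<close>

lemma hat_dilog:
  assumes "0 < w" "w \<le> pi" "\<bar>t\<bar> \<le> pi"
  shows "Re (2 * dilog (cis t) - dilog (cis (t + w)) - dilog (cis (t - w))) / (pi * w) + w / (2 * pi) = hat w t"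
proof -
  have *: "\<bar>t\<bar> \<le> 2 * pi" "\<bar>t + w\<bar> \<le> 2 * pi" "\<bar>t - w\<bar> \<le> 2 * pi" using assms by auto
  have "Re (2 * dilog (cis t) - dilog (cis (t + w)) - dilog (cis (t - w))) + w\<^sup>2 / 2 = pi * w * hat w t"
  proof (cases "\<bar>t\<bar> \<le> w")
    case True
    then have a: "(\<bar>t + w\<bar> = t + w) \<and> \<bar>t - w\<bar> = w - t" by auto
    show ?thesis using True assms(1) a
      by (cases "t \<ge> 0") (simp_all add: Re_dilog_cis[OF *(1)] Re_dilog_cis[OF *(2)] Re_dilog_cis[OF *(3)]
        hat_def field_simps power2_eq_square max_def)
  next
    case False
    show ?thesis 
    proof (cases "t \<ge> 0")
      case True
      have a: "(\<bar>t + w\<bar> = t + w) \<and> \<bar>t - w\<bar> = t - w" using True False assms by auto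
      show ?thesis using True False assms(1) a
        by (simp add: Re_dilog_cis[OF *(1)] Re_dilog_cis[OF *(2)] Re_dilog_cis[OF *(3)]
          hat_def field_simps power2_eq_square max_def)
    next
      case tneg: False
      have a: "(\<bar>t + w\<bar> = - t - w) \<and> \<bar>t - w\<bar> = w - t" using tneg False assms by auto
      show ?thesis using tneg False assms(1) a
        by (simp add: Re_dilog_cis[OF *(1)] Re_dilog_cis[OF *(2)] Re_dilog_cis[OF *(3)]
          hat_def field_simps power2_eq_square max_def)
    qed
  qed
  then show ?thesis using assms(1) by (simp add: field_simps power2_eq_square)
qed

lemma has_sum_hat:
  assumes "0 < w" "w \<le> pi" "\<bar>t\<bar> \<le> pi"
  shows "((\<lambda>k. of_real (hat_coeff w k) * cis (of_int k * t)) has_sum of_real (hat w t)) UNIV"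
proof -
  define f :: "real \<Rightarrow> nat \<Rightarrow> complex" where
    "f t n = of_real (if n = 0 then 0 else hat_coeff w (int n)) * cis (real n * t)" for t n
  define s where "s = (2 * dilog (cis t) - dilog (cis (t + w)) - dilog (cis (t - w))) / of_real (2 * pi * w)"
  have pos: "(f t has_sum s) UNIV"
    unfolding f_def s_def by (rule has_sum_hat_positive_frequencies[OF assms(1)])
  then have neg: "((\<lambda>n. cnj (f t n)) has_sum cnj s) UNIV" by simp
  have "((\<lambda>n. f t n + (if n = 0 then of_real (w / (2 * pi)) else 0)) has_sum s + of_real (w / (2 * pi))) UNIV"
    by (intro has_sum_add pos) (rule has_sum_finite_neutralI[of "{0}"]; auto)
  also have "(\<lambda>n. f t n + (if n = 0 then of_real (w / (2 * pi)) else 0)) =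
      (\<lambda>n. of_real (hat_coeff w (int n)) * cis (of_int (int n) * t))"
    by (auto simp: f_def hat_coeff_def)
  finally have A: "((\<lambda>n. of_real (hat_coeff w (int n)) * cis (of_int (int n) * t)) has_sum s + of_real (w / (2 * pi))) UNIV" .
  have "((\<lambda>n. cnj (f t n)) has_sum cnj s) (UNIV - {0})"
    using neg by (rule has_sum_cong_neutral[THEN iffD1, rotated -1]) (auto simp: f_def)
  then have B: "((\<lambda>n. of_real (hat_coeff w (- int n)) * cis (of_int (- int n) * t)) has_sum cnj s) (UNIV - {0})"
    by (rule has_sum_cong[THEN iffD1, rotated]) (auto simp: f_def hat_coeff_def cis_cnj)
  have "s + of_real (w / (2 * pi)) + cnj s = of_real (hat w t)"
  proof -
    have "2 * Re s = Re (2 * dilog (cis t) - dilog (cis (t + w)) - dilog (cis (t - w))) / (pi * w)"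
      unfolding s_def Re_divide_of_real using assms(1) by (simp add: divide_simps)
    then show ?thesis
      using hat_dilog[OF assms] by (simp add: complex_eq_iff)
  qed
  with has_sum_int[OF A B] show ?thesis by simp
qed

lemma has_sum_hat_coeff:
  assumes "0 < w" "w \<le> pi"
  shows "(hat_coeff w has_sum 1) UNIV"
proof -
  have "((\<lambda>k. of_real (hat_coeff w k) :: complex) has_sum of_real 1) UNIV"
    using has_sum_hat[OF assms, of 0] by (simp add: hat_def)
  then show ?thesis unfolding has_sum_of_real_iff .
qed

text \<open>
  An integral representation of the coefficients as a function of a continuous frequency, from which their Lipschitz bound is immediate.
\<close>

lemma one_minus_cos_eq_integral:
  fixes x :: real
  shows
  "((\<lambda>s. (1 - s) * cos (s * x)) has_integral (if x = 0 then 1/2 else (1 - cos x) / x\<^sup>2)) {0..1}"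
proof (cases "x = 0")
  case True
  have "((\<lambda>s::real. 1 - s) has_integral (1 - 1\<^sup>2/2) - (0 - 0\<^sup>2/2)) {0..1}"
    by (rule fundamental_theorem_of_calculus)
      (auto intro!: derivative_eq_intros simp flip: has_real_derivative_iff_has_vector_derivative)
  with True show ?thesis by simp
next
  case False
  have "((\<lambda>s. (1 - s) * cos (s * x)) has_integral
      ((1 - 1) * sin (1 * x) / x - cos (1 * x) / x\<^sup>2) - ((1 - 0) * sin (0 * x) / x - cos (0 * x) / x\<^sup>2)) {0..1}"
    by (rule fundamental_theorem_of_calculus)
      (use False in \<open>auto intro!: derivative_eq_intros
         simp: power2_eq_square field_simps simp flip: has_real_derivative_iff_has_vector_derivative\<close>)
  with False show ?thesis by (simp add: diff_divide_distrib)
qed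

lemma hat_coeff_lipschitz:
  assumes "w > 0"
  shows "\<bar>hat_coeff w k - hat_coeff w l\<bar> \<le> w\<^sup>2 * \<bar>of_int (k - l)\<bar>"
proof -
  have eq: "((\<lambda>s. w / pi * ((1 - s) * cos (s * (of_int k * w)))) has_integral hat_coeff w k) {0..1}" for k
  proof -
    have "hat_coeff w k = w / pi * (if of_int k * w = 0 then 1/2 else (1 - cos (of_int k * w)) / (of_int k * w)\<^sup>2)"
      using assms by (auto simp: hat_coeff_def power2_eq_square)
    then show ?thesis
      using has_integral_mult_right[OF one_minus_cos_eq_integral[of "of_int k * w"], of "w / pi"] by metis
  qed
  have int: "((\<lambda>s. w / pi * ((1 - s) * cos (s * (of_int k * w))) - w / pi * ((1 - s) * cos (s * (of_int l * w))))
      has_integral hat_coeff w k - hat_coeff w l) {0..1}"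
    by (intro has_integral_diff eq)
  have "\<bar>cos a - cos b\<bar> \<le> \<bar>a - b\<bar>" for a b :: real
  proof -
    have "norm (cos a - cos b) \<le> 1 * norm (a - b)"
      by (rule field_differentiable_bound[of UNIV cos "\<lambda>x. - sin x"])
        (auto intro!: derivative_eq_intros)
    then show ?thesis by simp
  qed
  note cos_lip = this
  have "norm (hat_coeff w k - hat_coeff w l) \<le> (w\<^sup>2 * \<bar>of_int (k - l)\<bar>) * measure lborel (cbox 0 (1::real))"
  proof (rule has_integral_bound)
    show "((\<lambda>s. w / pi * ((1 - s) * cos (s * (of_int k * w))) - w / pi * ((1 - s) * cos (s * (of_int l * w))))
      has_integral hat_coeff w k - hat_coeff w l) (cbox 0 1)" using int by simp
    fix s :: real assume "s \<in> cbox 0 1"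
    then have s: "0 \<le> s" "s \<le> 1" by auto
    have "\<bar>cos (s * (of_int k * w)) - cos (s * (of_int l * w))\<bar> \<le> \<bar>s * (of_int k * w) - s * (of_int l * w)\<bar>"
      by (rule cos_lip)
    also have "\<dots> = s * (w * \<bar>of_int (k - l)\<bar>)"
      using s assms by (simp add: abs_mult flip: right_diff_distrib left_diff_distrib)
    also have "\<dots> \<le> w * \<bar>of_int (k - l)\<bar>"
      using s assms by (simp add: mult_left_le_one_le)
    finally have c: "\<bar>cos (s * (of_int k * w)) - cos (s * (of_int l * w))\<bar> \<le> w * \<bar>of_int (k - l)\<bar>" .
    have "norm (w / pi * ((1 - s) * cos (s * (of_int k * w))) - w / pi * ((1 - s) * cos (s * (of_int l * w)))) =
      (w / pi * (1 - s)) * \<bar>cos (s * (of_int k * w)) - cos (s * (of_int l * w))\<bar>"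
    proof -
      have "w / pi * ((1 - s) * cos (s * (of_int k * w))) - w / pi * ((1 - s) * cos (s * (of_int l * w))) =
        (w / pi * (1 - s)) * (cos (s * (of_int k * w)) - cos (s * (of_int l * w)))"
        by (simp add: algebra_simps diff_divide_distrib)
      moreover have "w / pi * (1 - s) \<ge> 0" using s assms by simp
      ultimately show ?thesis by (metis abs_mult abs_of_nonneg real_norm_def)
    qed
    also have "\<dots> \<le> w * (w * \<bar>of_int (k - l)\<bar>)"
    proof (intro mult_mono c)
      have "w / pi * (1 - s) \<le> w / pi * 1" using s assms by (intro mult_left_mono) auto
      also have "\<dots> \<le> w" using assms pi_gt3 by (simp add: divide_le_eq)
      finally show "w / pi * (1 - s) \<le> w" .
    qed (use assms in auto)
    finally show "norm (w / pi * ((1 - s) * cos (s * (of_int k * w))) - w / pi * ((1 - s) * cos (s * (of_int l * w))))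
       \<le> w\<^sup>2 * \<bar>of_int (k - l)\<bar>" by (simp add: power2_eq_square)
  qed auto
  then show ?thesis by simp
qed

lemma hat_coeff_decay:
  assumes "0 < w" "w \<le> 1"
  shows "hat_coeff w k \<le> 4 / (w * (1 + \<bar>of_int k\<bar>)\<^sup>2)"
proof (cases "k = 0")
  case True
  have "w * w \<le> 1 * 1" using assms by (intro mult_mono) auto
  also have "\<dots> \<le> 4 * (2 * pi)" using pi_gt3 by simp
  finally show ?thesis using True assms by (simp add: hat_coeff_def field_simps)
next
  case False
  define m where "m = \<bar>real_of_int k\<bar>"
  have m: "m \<ge> 1" using False by (simp add: m_def)
  have "hat_coeff w k \<le> 2 / (pi * w * of_int k ^ 2)"
    using False assms cos_ge_minus_one[of "k * w"] by (auto simp: hat_coeff_def intro!: divide_right_mono)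
  also have "\<dots> = 2 / pi * (1 / (w * m\<^sup>2))" by (simp add: m_def)
  also have "\<dots> \<le> 1 * (1 / (w * m\<^sup>2))"
    using pi_gt3 assms by (intro mult_right_mono) auto
  also have "\<dots> = 4 / (w * (2 * m)\<^sup>2)" by (simp add: power2_eq_square)
  also have "\<dots> \<le> 4 / (w * (1 + m)\<^sup>2)"
    using m assms by (intro divide_left_mono mult_left_mono power_mono mult_pos_pos) auto
  finally show ?thesis by (simp add: m_def)
qed

lemma summable_on_int_powr:
  assumes "p < -1"
  shows "(\<lambda>k::int. (1 + \<bar>real_of_int k\<bar>) powr p) summable_on UNIV"
proof -
  have "summable (\<lambda>n. real (Suc n) powr p)"
    using assms by (subst summable_Suc_iff) (simp add: summable_real_powr_iff)
  then have *: "(\<lambda>n. (1 + real n) powr p) summable_on UNIV"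
    by (intro norm_summable_imp_summable_on) (simp add: add.commute)
  then obtain s where s: "((\<lambda>n. (1 + real n) powr p) has_sum s) UNIV" by (auto simp: summable_on_def)
  from * have "(\<lambda>n. (1 + real n) powr p) summable_on (UNIV - {0})"
    by (rule summable_on_subset_banach) auto
  then obtain s' where s': "((\<lambda>n. (1 + real n) powr p) has_sum s') (UNIV - {0})" by (auto simp: summable_on_def)
  have "((\<lambda>k::int. (1 + \<bar>real_of_int k\<bar>) powr p) has_sum (s + s')) UNIV"
    using s s' by (intro has_sum_int) auto
  then show ?thesis by (auto simp: summable_on_def)
qed

text \<open>
  The increment \<open>d\<close> is at most of order \<open>w\<^sup>2\<close> by the Lipschitz bound and at most of order
  \<open>1 / (w k\<^sup>2)\<close> by decay.  The interpolation \<open>d = d powr (2/5) * d powr (3/5)\<close> uses both; an exponent \<open>\<theta>\<close> on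
  the second bound leaves \<open>w powr (2 - 3\<theta>)\<close> and \<open>k powr (-2\<theta>)\<close>.  So \<open>\<theta> = 3/5\<close>, lying between \<open>1/2\<close>
  and \<open>2/3\<close>, gives a bound that is summable in \<open>k\<close> and vanishes with \<open>w\<close>.
\<close>

lemma hat_coeff_shift_bound:
  fixes k n :: int
  assumes "0 < w" "w \<le> 1"
  defines "n' \<equiv> 1 + \<bar>real_of_int n\<bar>"
  shows "\<bar>hat_coeff w (k - n) - hat_coeff w k\<bar> \<le>
    n' powr (2/5) * (8 * n'\<^sup>2) powr (3/5) * w powr (1/5) * (1 + \<bar>of_int k\<bar>) powr (- 6/5)"
proof -
  define d where "d = \<bar>hat_coeff w (k - n) - hat_coeff w k\<bar>"
  define m where "m = 1 + \<bar>real_of_int k\<bar>"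
  have n': "n' \<ge> 1" and m: "m \<ge> 1" by (auto simp: n'_def m_def)
  have "d \<le> w\<^sup>2 * \<bar>of_int (k - n - k)\<bar>"
    unfolding d_def by (rule hat_coeff_lipschitz[OF assms(1)])
  also have "\<dots> \<le> w\<^sup>2 * n'" by (intro mult_left_mono) (auto simp: n'_def)
  finally have A: "d \<le> w\<^sup>2 * n'" .
  have "m \<le> n' * (1 + \<bar>of_int (k - n)\<bar>)"
  proof -
    have "m \<le> 1 + \<bar>real_of_int n\<bar> + \<bar>of_int (k - n)\<bar>" by (simp add: m_def)
    also have "\<dots> \<le> n' * (1 + \<bar>of_int (k - n)\<bar>)"
      by (simp add: n'_def algebra_simps flip: abs_mult)
    finally show ?thesis .
  qed
  then have le: "m\<^sup>2 \<le> (n' * (1 + \<bar>of_int (k - n)\<bar>))\<^sup>2"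
    using m by (intro power_mono) auto
  have "4 / (w * (1 + \<bar>of_int (k - n)\<bar>)\<^sup>2) = 4 * n'\<^sup>2 / (w * (n' * (1 + \<bar>of_int (k - n)\<bar>))\<^sup>2)"
    using n' by (simp add: power_mult_distrib)
  also have "\<dots> \<le> 4 * n'\<^sup>2 / (w * m\<^sup>2)"
    using assms(1) m n' by (intro divide_left_mono mult_left_mono le) auto
  finally have "4 / (w * (1 + \<bar>of_int (k - n)\<bar>)\<^sup>2) \<le> 4 * n'\<^sup>2 / (w * m\<^sup>2)" .
  moreover have "4 / (w * m\<^sup>2) \<le> 4 * n'\<^sup>2 / (w * m\<^sup>2)"
    using assms(1) n' by (intro divide_right_mono) (auto simp: one_le_power)
  moreover have "d \<le> max (hat_coeff w (k - n)) (hat_coeff w k)"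
    using hat_coeff_nonneg[OF assms(1)] by (auto simp: d_def abs_if max_def)
  ultimately have "d \<le> 4 * n'\<^sup>2 / (w * m\<^sup>2)"
    using hat_coeff_decay[OF assms(1,2), of k] hat_coeff_decay[OF assms(1,2), of "k - n"]
    by (auto simp: m_def max_def split: if_splits)
  also have "\<dots> \<le> 8 * n'\<^sup>2 / (w * m\<^sup>2)"
    using assms(1) by (intro divide_right_mono) auto
  finally have B: "d \<le> 8 * n'\<^sup>2 / (w * m\<^sup>2)" .
  have d0: "d \<ge> 0" by (simp add: d_def)
  have "d = d powr (2/5) * d powr (3/5)"
    using d0 by (simp flip: powr_add)
  also have "\<dots> \<le> (w\<^sup>2 * n') powr (2/5) * (8 * n'\<^sup>2 / (w * m\<^sup>2)) powr (3/5)"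
    using A B d0 by (intro mult_mono powr_mono2) auto
  also have "\<dots> = n' powr (2/5) * (8 * n'\<^sup>2) powr (3/5) * w powr (1/5) * m powr (- 6/5)"
  proof -
    have "(w\<^sup>2) powr (2/5) = w powr (4/5)" "(m\<^sup>2) powr (3/5) = m powr (6/5)"
      using assms(1) m by (simp_all add: powr_powr flip: powr_numeral)
    moreover have "w powr (4/5) = w powr (1/5) * w powr (3/5)" by (simp flip: powr_add)
    ultimately show ?thesis
      using assms(1) m n' by (simp add: powr_mult powr_divide powr_minus_divide)
  qed
  finally show ?thesis by (simp add: d_def m_def)
qed

lemma hat_coeff_shift_tendsto_0:
  "((\<lambda>w. \<Sum>\<^sub>\<infinity>k. \<bar>hat_coeff w (k - n) - hat_coeff w k\<bar>) \<longlongrightarrow> 0) (at_right 0)"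
proof -
  define K where "K = (1 + \<bar>real_of_int n\<bar>) powr (2/5) * (8 * (1 + \<bar>real_of_int n\<bar>)\<^sup>2) powr (3/5)"
  define S where "S = (\<Sum>\<^sub>\<infinity>k. (1 + \<bar>real_of_int k\<bar>) powr (- 6/5))"
  have sm: "(\<lambda>k. (1 + \<bar>real_of_int k\<bar>) powr (- 6/5)) summable_on UNIV"
    by (rule summable_on_int_powr) simp
  have "(\<Sum>\<^sub>\<infinity>k. \<bar>hat_coeff w (k - n) - hat_coeff w k\<bar>) \<le> K * w powr (1/5) * S" if "0 < w" "w \<le> 1" for w
  proof -
    have "(\<Sum>\<^sub>\<infinity>k. \<bar>hat_coeff w (k - n) - hat_coeff w k\<bar>) \<le>
       (\<Sum>\<^sub>\<infinity>k. (K * w powr (1/5)) * (1 + \<bar>real_of_int k\<bar>) powr (- 6/5))"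
    proof (rule infsum_mono)
      show "(\<lambda>k. K * w powr (1/5) * (1 + \<bar>real_of_int k\<bar>) powr (- 6/5)) summable_on UNIV"
        by (intro summable_on_cmult_right sm)
      then show "(\<lambda>k. \<bar>hat_coeff w (k - n) - hat_coeff w k\<bar>) summable_on UNIV"
        by (rule summable_on_comparison_test) (use hat_coeff_shift_bound[OF that] in \<open>auto simp: K_def\<close>)
      show "\<bar>hat_coeff w (k - n) - hat_coeff w k\<bar> \<le> K * w powr (1/5) * (1 + \<bar>real_of_int k\<bar>) powr (- 6/5)" for k
        using hat_coeff_shift_bound[OF that, of k n] by (simp add: K_def)
    qed
    also have "\<dots> = K * w powr (1/5) * S"
      unfolding S_def by (rule infsum_cmult_right') 
    finally show ?thesis .
  qed
  then have ub: "eventually (\<lambda>w. (\<Sum>\<^sub>\<infinity>k. \<bar>hat_coeff w (k - n) - hat_coeff w k\<bar>) \<le> K * w powr (1/5) * S) (at_right 0)"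
    unfolding eventually_at_right_field by (intro exI[of _ 1]) auto
  have lim: "((\<lambda>w. K * w powr (1/5) * S) \<longlongrightarrow> K * 0 * S) (at_right 0)"
    by (intro tendsto_intros tendsto_zero_powrI[OF tendsto_ident_at tendsto_const])
      (auto intro: eventually_mono[OF eventually_at_right_less])
  show ?thesis
  proof (rule tendsto_sandwich[OF _ ub tendsto_const])
    show "((\<lambda>w. K * w powr (1/5) * S) \<longlongrightarrow> 0) (at_right 0)" using lim by simp
  qed (auto intro!: always_eventually infsum_nonneg)
qed

section \<open>Cut-off functions and localisation\<close>

text \<open>
  The difference \<open>2 * hat (2 * w) - hat w\<close> is a trapezoid: it is \<open>1\<close> on \<open>[-w, w]\<close> and \<open>0\<close> outside \<open>[-2w, 2w]\<close>.
\<close>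

definition cutoff_coeff :: "real \<Rightarrow> int \<Rightarrow> complex" where
  "cutoff_coeff w k = of_real (2 * hat_coeff (2 * w) k - hat_coeff w k)"

abbreviation complex_fourier_sum :: "(int \<Rightarrow> complex) \<Rightarrow> real \<Rightarrow> complex" where
  "complex_fourier_sum \<equiv> fourier_sum (*) UNIV cmod"

definition cutoff :: "real \<Rightarrow> real \<Rightarrow> complex" where
  "cutoff w = complex_fourier_sum (cutoff_coeff w)"

interpretation complex: complex_banach_subspace "(*)" "UNIV :: complex set" cmod
  by (rule complex_banach_subspace_complex)

lemma cutoff_coeff_ell1:
  assumes "0 < w" "w \<le> 1/2"
  shows "cutoff_coeff w \<in> ell1 UNIV cmod" "ell1_norm cmod (cutoff_coeff w) \<le> 3"
proof -
  have s: "(hat_coeff (2 * w) has_sum 1) UNIV" "(hat_coeff w has_sum 1) UNIV"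
    using assms pi_gt3 by (auto intro!: has_sum_hat_coeff)
  have sum: "((\<lambda>k. 2 * hat_coeff (2 * w) k + hat_coeff w k) has_sum 2 * 1 + 1) UNIV"
    by (intro has_sum_add has_sum_cmult_right s)
  have le: "cmod (cutoff_coeff w k) \<le> 2 * hat_coeff (2 * w) k + hat_coeff w k" for k
    using hat_coeff_nonneg[of w k] hat_coeff_nonneg[of "2 * w" k] assms
    unfolding cutoff_coeff_def norm_of_real by linarith
  show mem: "cutoff_coeff w \<in> ell1 UNIV cmod"
    by (rule complex.ell1I[OF _ le has_sum_imp_summable[OF sum]]) auto
  show "ell1_norm cmod (cutoff_coeff w) \<le> 3"
    using complex.ell1_norm_le[OF mem le has_sum_imp_summable[OF sum]] infsumI[OF sum] by simp
qed

lemma cutoff_eq: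
  assumes "0 < w" "w \<le> 1/2" "\<bar>t\<bar> \<le> pi"
  shows "cutoff w t = of_real (2 * hat (2 * w) t - hat w t)"
  unfolding cutoff_def
proof (rule complex.fourier_sum_eqI)
  have "((\<lambda>k. 2 * (of_real (hat_coeff (2 * w) k) * cis (of_int k * t)) +
        - 1 * (of_real (hat_coeff w k) * cis (of_int k * t)))
      has_sum 2 * of_real (hat (2 * w) t) + - 1 * of_real (hat w t)) UNIV"
    using assms pi_gt3 by (intro has_sum_add has_sum_cmult_right has_sum_hat) auto
  then show "sums_in UNIV cmod (\<lambda>k. cis (of_int k * t) * cutoff_coeff w k) (of_real (2 * hat (2 * w) t - hat w t))"
    by (simp add: sums_in_complex_iff cutoff_coeff_def algebra_simps)
qed

lemma cutoff_eq_1: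
  assumes "0 < w" "w \<le> 1/2" "\<bar>t\<bar> \<le> w"
  shows "cutoff w t = 1"
proof -
  have "2 * hat (2 * w) t - hat w t = 1"
    using assms by (simp add: hat_def field_simps max_def)
  moreover have "\<bar>t\<bar> \<le> pi" using assms pi_gt3 by simp
  ultimately show ?thesis using cutoff_eq[OF assms(1,2)] by (metis of_real_1)
qed

lemma cutoff_eq_0:
  assumes "0 < w" "w \<le> 1/2" "2 * w \<le> \<bar>t\<bar>" "\<bar>t\<bar> \<le> pi"
  shows "cutoff w t = 0"
proof -
  have "2 * hat (2 * w) t - hat w t = 0"
    using assms by (simp add: hat_def field_simps max_def)
  then show ?thesis using cutoff_eq[OF assms(1,2,4)] by (metis of_real_0)
qed

lemma shift_into_period: "\<exists>j. t + 2 * pi * of_int j \<in> {-pi..<pi}"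
proof -
  define j where "j = - \<lfloor>(t + pi) / (2 * pi)\<rfloor>"
  have "of_int (- j) \<le> (t + pi) / (2 * pi)" "(t + pi) / (2 * pi) < of_int (- j) + 1"
    unfolding j_def by linarith+
  then have "- of_int j * (2 * pi) \<le> t + pi" "t + pi < (- of_int j + 1) * (2 * pi)"
    by (simp_all add: pos_le_divide_eq pos_divide_less_eq)
  then show ?thesis by (intro exI[of _ j]) (simp add: algebra_simps)
qed

text \<open>
  The wide cut-off is \<open>1\<close> wherever the narrow one lives.  Changing a function
  where the wide cut-off differs from \<open>1\<close> thus does not affect its product with the narrow one.
\<close>

lemma cutoff_nested:
  assumes "0 < w" "w \<le> 1/4"
  shows "cutoff w t = 0 \<or> cutoff (2 * w) t = 1"
proof -
  obtain j where j: "t + 2 * pi * of_int j \<in> {-pi..<pi}" using shift_into_period by blast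
  define s where "s = t + 2 * pi * of_int j"
  have s: "\<bar>s\<bar> \<le> pi" using j by (auto simp: s_def)
  have "cutoff w t = cutoff w s" for w
    unfolding cutoff_def s_def by (rule complex.fourier_sum_periodic[symmetric])
  moreover have "cutoff w s = 0 \<or> cutoff (2 * w) s = 1"
    using cutoff_eq_0[of w s] cutoff_eq_1[of "2 * w" s] assms s by (cases "2 * w \<le> \<bar>s\<bar>") auto
  ultimately show ?thesis by simp
qed

lemma cutoff_coeff_shift:
  assumes "0 < w" "w \<le> 1/2"
  shows "(\<lambda>k. cutoff_coeff w (k - n) - cutoff_coeff w k) \<in> ell1 UNIV cmod"
    "ell1_norm cmod (\<lambda>k. cutoff_coeff w (k - n) - cutoff_coeff w k) \<le> 6"
proof -
  interpret L: complex_normed_subspace "\<lambda>z c n. z * c n" "ell1 UNIV cmod" "ell1_norm cmod"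
    by (rule complex.complex_normed_subspace_ell1)
  note c = cutoff_coeff_ell1[OF assms]
  note sh = complex.ell1_shift[OF c(1), of n]
  show "(\<lambda>k. cutoff_coeff w (k - n) - cutoff_coeff w k) \<in> ell1 UNIV cmod"
    using L.diff_mem[OF sh(1) c(1)] by (simp add: fun_diff_def)
  show "ell1_norm cmod (\<lambda>k. cutoff_coeff w (k - n) - cutoff_coeff w k) \<le> 6"
    using L.norm_diff_le[OF sh(1) c(1)] c(2) sh(2) by (simp add: fun_diff_def)
qed

lemma cutoff_coeff_shift_tendsto_0:
  "((\<lambda>w. ell1_norm cmod (\<lambda>k. cutoff_coeff w (k - n) - cutoff_coeff w k)) \<longlongrightarrow> 0) (at_right 0)"
proof -
  define V where "V w = (\<Sum>\<^sub>\<infinity>k. \<bar>hat_coeff w (k - n) - hat_coeff w k\<bar>)" for w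
  have V: "(V \<longlongrightarrow> 0) (at_right 0)"
    unfolding V_def by (rule hat_coeff_shift_tendsto_0)
  have "filterlim (\<lambda>w::real. 2 * w) (at_right 0) (at_right 0)"
    by (auto simp: filterlim_at eventually_at_right_less intro!: tendsto_eq_intros eventually_mono[OF eventually_at_right_less])
  from filterlim_compose[OF V this] have V2: "((\<lambda>w. V (2 * w)) \<longlongrightarrow> 0) (at_right 0)" .
  have "ell1_norm cmod (\<lambda>k. cutoff_coeff w (k - n) - cutoff_coeff w k) \<le> 2 * V (2 * w) + V w"
    if w: "0 < w" "w < 1/2" for w
  proof -
    have summable: "(\<lambda>k. \<bar>hat_coeff w (k - n) - hat_coeff w k\<bar>) summable_on UNIV" if "0 < w" "w \<le> 1" for w
    proof (rule summable_on_comparison_test)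
      have hs: "hat_coeff w summable_on UNIV"
        using has_sum_hat_coeff[of w] that pi_gt3 by (auto simp: summable_on_def)
      moreover have "bij (\<lambda>k::int. k - n)" by (rule bij_betwI[of _ _ _ "\<lambda>k. k + n"]) auto
      ultimately have "(\<lambda>k. hat_coeff w (k - n)) summable_on UNIV"
        using summable_on_reindex_bij_betw[of "\<lambda>k. k - n" UNIV UNIV "hat_coeff w"] by simp
      with hs show "(\<lambda>k. hat_coeff w (k - n) + hat_coeff w k) summable_on UNIV"
        by (rule summable_on_add[rotated])
      show "\<bar>hat_coeff w (k - n) - hat_coeff w k\<bar> \<le> hat_coeff w (k - n) + hat_coeff w k" for k
        using hat_coeff_nonneg[OF that(1)] by (simp add: abs_le_iff)
    qed auto
    have s: "(\<lambda>k. 2 * \<bar>hat_coeff (2 * w) (k - n) - hat_coeff (2 * w) k\<bar> + \<bar>hat_coeff w (k - n) - hat_coeff w k\<bar>) summable_on UNIV"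
      using w by (intro summable_on_add summable_on_cmult_right summable) auto
    have "ell1_norm cmod (\<lambda>k. cutoff_coeff w (k - n) - cutoff_coeff w k) \<le>
        (\<Sum>\<^sub>\<infinity>k. 2 * \<bar>hat_coeff (2 * w) (k - n) - hat_coeff (2 * w) k\<bar> + \<bar>hat_coeff w (k - n) - hat_coeff w k\<bar>)"
    proof (rule complex.ell1_norm_le[OF cutoff_coeff_shift(1) _ s])
      fix k
      have "cutoff_coeff w (k - n) - cutoff_coeff w k =
        of_real (2 * (hat_coeff (2 * w) (k - n) - hat_coeff (2 * w) k) - (hat_coeff w (k - n) - hat_coeff w k))"
        by (simp add: cutoff_coeff_def)
      moreover have "\<bar>2 * p - q\<bar> \<le> 2 * \<bar>p\<bar> + \<bar>q\<bar>" for p q :: real by linarith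
      ultimately show "cmod (cutoff_coeff w (k - n) - cutoff_coeff w k) \<le>
          2 * \<bar>hat_coeff (2 * w) (k - n) - hat_coeff (2 * w) k\<bar> + \<bar>hat_coeff w (k - n) - hat_coeff w k\<bar>"
        by (simp only: norm_of_real)
    qed (use w in auto)
    also have "\<dots> = 2 * V (2 * w) + V w"
      unfolding V_def using w
      by (subst infsum_add) (auto intro!: summable_on_cmult_right summable simp: infsum_cmult_right')
    finally show ?thesis .
  qed
  then have ub: "eventually (\<lambda>w. ell1_norm cmod (\<lambda>k. cutoff_coeff w (k - n) - cutoff_coeff w k) \<le> 2 * V (2 * w) + V w) (at_right 0)"
    unfolding eventually_at_right_field by (intro exI[of _ "1/2"]) auto
  show ?thesis
  proof (rule tendsto_sandwich[OF _ ub tendsto_const])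
    show "((\<lambda>w. 2 * V (2 * w) + V w) \<longlongrightarrow> 0) (at_right 0)"
      by (rule tendsto_eq_rhs[OF tendsto_add[OF tendsto_mult_left[OF V2] V]]) simp
  qed (auto simp: ell1_norm_def intro!: always_eventually infsum_nonneg)
qed

text \<open>
  Translating a function by \<open>t0\<close> multiplies its coefficients by characters.
\<close>

definition modulate :: "real \<Rightarrow> (int \<Rightarrow> complex) \<Rightarrow> int \<Rightarrow> complex" where
  "modulate t0 c k = cis (- of_int k * t0) * c k"

lemma modulate:
  shows "c \<in> ell1 UNIV cmod \<Longrightarrow> modulate t0 c \<in> ell1 UNIV cmod"
    "complex_fourier_sum (modulate t0 c) t = complex_fourier_sum c (t - t0)"
proof -
  show "c \<in> ell1 UNIV cmod \<Longrightarrow> modulate t0 c \<in> ell1 UNIV cmod"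
    by (simp add: ell1_def modulate_def norm_mult)
  have "cis (of_int k * t) * modulate t0 c k = cis (of_int k * (t - t0)) * c k" for k
    by (simp add: modulate_def cis_mult algebra_simps flip: mult.assoc)
  then show "complex_fourier_sum (modulate t0 c) t = complex_fourier_sum c (t - t0)"
    by (simp add: fourier_sum_def)
qed

context complex_banach_subspace
begin

text \<open>
  The function \<open>f t - f t0\<close> is the series of \<open>(cis (n t) - cis (n t0)) c\<^sub>n\<close>.  Multiplying \<open>cis (n t) - cis (n t0)\<close>
  by the cut-off centred at \<open>t0\<close> gives, up to unimodular factors, the difference of the cut-off's
  coefficient sequence and its shift by \<open>n\<close>.
\<close>

lemma cutoff_increment_bound:
  assumes c: "c \<in> ell1 V N" and w: "0 < w" "w \<le> 1/2"
  obtains z where "z \<in> ell1 V N"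
    "ell1_norm N z \<le> (\<Sum>\<^sub>\<infinity>n. N (c n) * ell1_norm cmod (\<lambda>k. cutoff_coeff w (k - n) - cutoff_coeff w k))"
    "\<And>t. fourier_sum smul V N z t =
       smul (cutoff w (t - t0)) (fourier_sum smul V N c t - fourier_sum smul V N c t0)"
proof -
  interpret L: complex_normed_subspace "\<lambda>z c n. smul z (c n)" "ell1 V N" "ell1_norm N"
    by (rule complex_normed_subspace_ell1)
  define D where "D n = ell1_norm cmod (\<lambda>k. cutoff_coeff w (k - n) - cutoff_coeff w k)" for n
  define f where "f = modulate t0 (cutoff_coeff w)"
  define u where "u n k = f (k - n) - cis (of_int n * t0) * f k" for n k
  have f: "f \<in> ell1 UNIV cmod" unfolding f_def by (intro modulate(1) cutoff_coeff_ell1 w)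
  have norm_u: "cmod (u n k) = cmod (cutoff_coeff w (k - n) - cutoff_coeff w k)" for n k
  proof -
    have "u n k = cis (- of_int (k - n) * t0) * (cutoff_coeff w (k - n) - cutoff_coeff w k)"
      by (simp add: u_def f_def modulate_def cis_mult algebra_simps flip: mult.assoc)
    then show ?thesis by (simp add: norm_mult)
  qed
  have u: "u n \<in> ell1 UNIV cmod" "ell1_norm cmod (u n) = D n" for n
    using cutoff_coeff_shift(1)[OF w, of n] by (auto simp: ell1_def D_def ell1_norm_def norm_u)
  have u_sum: "complex_fourier_sum (u n) t = cutoff w (t - t0) * (cis (of_int n * t) - cis (of_int n * t0))" for n t
  proof -
    interpret CL: complex_normed_subspace "\<lambda>z c n. z * c n" "ell1 UNIV cmod" "ell1_norm cmod"
      by (rule complex.complex_normed_subspace_ell1)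
    have g: "(\<lambda>k. cis (of_int n * t0) * f k) \<in> ell1 UNIV cmod" by (rule CL.smul_mem[OF f])
    have "complex_fourier_sum (\<lambda>k. cis (of_int n * t0) * f k) t = cis (of_int n * t0) * complex_fourier_sum f t"
      using complex.sums_in_smul[OF complex.sums_in_fourier_sum[OF f, of t], of "cis (of_int n * t0)"]
      by (intro complex.fourier_sum_eqI) (simp add: mult_ac)
    moreover have u_eq: "u n = (\<lambda>k. f (k - n)) - (\<lambda>k. cis (of_int n * t0) * f k)"
      by (simp add: u_def fun_eq_iff)
    moreover have "complex_fourier_sum f t = cutoff w (t - t0)"
      by (simp add: f_def cutoff_def modulate(2))
    ultimately show ?thesis
      unfolding u_eq complex.fourier_sum_diff[OF complex.ell1_shift(1)[OF f, of n] g]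
        complex.ell1_shift(3)[OF f] by (simp add: algebra_simps)
  qed
  define Z where "Z n = (\<lambda>k. smul (u n k) (c n))" for n
  note image = ell1_bounded_linear_image[OF complex_banach_subspace_complex complex_banach_subspace_axioms,
      where T = "\<lambda>z. smul z (c n)" and C = "N (c n)" for n, OF _ _ _ _ u(1)]
  have Z: "Z n \<in> ell1 V N" "ell1_norm N (Z n) \<le> N (c n) * D n"
    "fourier_sum smul V N (Z n) t = smul (complex_fourier_sum (u n) t) (c n)" for n t
    unfolding Z_def u(2)[symmetric]
    by (rule image; use c in \<open>simp add: ell1_mem smul_mem scale_left_distrib norm_scale\<close>)+
  have s: "(\<lambda>n. N (c n) * D n) summable_on UNIV"
  proof (rule summable_on_comparison_test)
    show "(\<lambda>n. N (c n) * 6) summable_on UNIV"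
      by (intro summable_on_cmult_left ell1_summable c)
    show "N (c n) * D n \<le> N (c n) * 6" for n
      unfolding D_def using c by (intro mult_left_mono cutoff_coeff_shift w norm_nonneg ell1_mem)
    show "0 \<le> N (c n) * D n" for n
      unfolding D_def ell1_norm_def using c by (intro mult_nonneg_nonneg norm_nonneg infsum_nonneg ell1_mem) auto
  qed
  have sZ: "(\<lambda>n. ell1_norm N (Z n)) summable_on UNIV"
    by (rule summable_on_comparison_test[OF s]) (use Z L.norm_nonneg in auto)
  obtain z where z: "z \<in> ell1 V N" "ell1_norm N z \<le> (\<Sum>\<^sub>\<infinity>n. ell1_norm N (Z n))"
    "\<And>t. sums_in V N (\<lambda>n. fourier_sum smul V N (Z n) t) (fourier_sum smul V N z t)"
    using fourier_sum_series[OF Z(1) sZ] by blast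
  have "(\<Sum>\<^sub>\<infinity>n. ell1_norm N (Z n)) \<le> (\<Sum>\<^sub>\<infinity>n. N (c n) * D n)"
    by (intro infsum_mono sZ s Z(2))
  moreover have "fourier_sum smul V N z t =
       smul (cutoff w (t - t0)) (fourier_sum smul V N c t - fourier_sum smul V N c t0)" for t
  proof (rule sums_in_unique[OF z(3)])
    show "sums_in V N (\<lambda>n. fourier_sum smul V N (Z n) t)
      (smul (cutoff w (t - t0)) (fourier_sum smul V N c t - fourier_sum smul V N c t0))"
      using sums_in_smul[OF sums_in_diff[OF sums_in_fourier_sum[OF c, of t] sums_in_fourier_sum[OF c, of t0]],
          of "cutoff w (t - t0)"]
      by (simp add: Z(3) u_sum scale_left_diff_distrib scale_right_diff_distrib right_diff_distrib)
  qed
  ultimately show ?thesis using that z by (force simp: D_def)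
qed

text \<open>
  Wiener's localisation lemma: near \<open>t0\<close>, a Wiener function is close to its value at \<open>t0\<close> in the Wiener norm, not only
  uniformly.  Each term of the series in the preceding bound tends to \<open>0\<close> with \<open>w\<close>, and the terms are dominated
  by \<open>6 * N (c n)\<close> uniformly in \<open>w\<close>.
\<close>

lemma cutoff_increment_small:
  assumes c: "c \<in> ell1 V N" and "\<epsilon> > 0"
  shows "eventually (\<lambda>w. \<exists>z\<in>ell1 V N. ell1_norm N z < \<epsilon> \<and>
    (\<forall>t. fourier_sum smul V N z t =
       smul (cutoff w (t - t0)) (fourier_sum smul V N c t - fourier_sum smul V N c t0))) (at_right 0)"
proof -
  define D where "D w n = ell1_norm cmod (\<lambda>k. cutoff_coeff w (k - n) - cutoff_coeff w k)" for w n
  have at: "at_right 0 = at (0::real) within {0<..1/2}"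
    by (rule at_within_nhd[of 0 "{..<1/2}"]) auto
  have "uniform_limit {0<..1/2} (\<lambda>F w. \<Sum>n\<in>F. N (c n) * D w n) (\<lambda>w. \<Sum>\<^sub>\<infinity>n. N (c n) * D w n)
      (finite_subsets_at_top UNIV)"
  proof (rule Weierstrass_m_test_general)
    show "(\<lambda>n. N (c n) * 6) summable_on UNIV"
      by (intro summable_on_cmult_left ell1_summable c)
    show "norm (N (c n) * D w n) \<le> N (c n) * 6" if "w \<in> {0<..1/2}" for n w
    proof -
      have "0 \<le> D w n" by (auto simp: D_def ell1_norm_def intro: infsum_nonneg)
      moreover have "D w n \<le> 6" unfolding D_def using that by (intro cutoff_coeff_shift) auto
      ultimately show ?thesis using norm_nonneg[OF ell1_mem[OF c]]
        by (simp add: abs_mult mult_left_mono)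
    qed
  qed
  then have "((\<lambda>w. \<Sum>\<^sub>\<infinity>n. N (c n) * D w n) \<longlongrightarrow> 0) (at 0 within {0<..1/2})"
  proof (rule swap_uniform_limit[rotated 2])
    show "\<forall>\<^sub>F F in finite_subsets_at_top UNIV. ((\<lambda>w. \<Sum>n\<in>F. N (c n) * D w n) \<longlongrightarrow> (\<lambda>_. 0) F) (at 0 within {0<..1/2})"
    proof (intro always_eventually allI)
      fix F
      have "((\<lambda>w. \<Sum>n\<in>F. N (c n) * D w n) \<longlongrightarrow> (\<Sum>n\<in>F. N (c n) * 0)) (at 0 within {0<..1/2})"
        unfolding at[symmetric] D_def by (intro tendsto_intros cutoff_coeff_shift_tendsto_0)
      then show "((\<lambda>w. \<Sum>n\<in>F. N (c n) * D w n) \<longlongrightarrow> (\<lambda>_. 0) F) (at 0 within {0<..1/2})" by simp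
    qed
  qed auto
  then have "eventually (\<lambda>w. (\<Sum>\<^sub>\<infinity>n. N (c n) * D w n) < \<epsilon>) (at_right 0)"
    unfolding at using \<open>\<epsilon> > 0\<close> by (intro order_tendstoD(2)) auto
  moreover have "eventually (\<lambda>w::real. 0 < w \<and> w \<le> 1/2) (at_right 0)"
    unfolding eventually_at_right_field by (intro exI[of _ "1/2"]) auto
  ultimately show ?thesis
  proof eventually_elim
    case (elim w)
    then obtain z where "z \<in> ell1 V N" "ell1_norm N z \<le> (\<Sum>\<^sub>\<infinity>n. N (c n) * D w n)"
      "\<And>t. fourier_sum smul V N z t =
         smul (cutoff w (t - t0)) (fourier_sum smul V N c t - fourier_sum smul V N c t0)"
      using cutoff_increment_bound[OF c, of w t0] unfolding D_def by blast
    with elim show ?case by (intro bexI[of _ z]) auto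
  qed
qed

end

section \<open>Closure properties of Wiener spaces and Wiener algebras\<close>

lemma sums_in_Suc:
  assumes "sums_in V N c s" "s - c 0 \<in> V"
  shows "sums_in V N (\<lambda>n. c (Suc n)) (s - c 0)"
proof -
  have "filterlim (\<lambda>F. insert 0 (Suc ` F)) (finite_subsets_at_top UNIV) (finite_subsets_at_top UNIV)"
  proof (rule filterlim_finite_subsets_at_top[THEN iffD2], intro allI impI)
    fix X :: "nat set" assume "finite X \<and> X \<subseteq> UNIV"
    then have "finite (Suc -` X)" by (simp add: finite_vimageI)
    moreover have "X \<subseteq> insert 0 (Suc ` F)" if "Suc -` X \<subseteq> F" for F
    proof
      fix x assume "x \<in> X" with that show "x \<in> insert 0 (Suc ` F)" by (cases x) auto
    qed
    ultimately show "\<forall>\<^sub>F F in finite_subsets_at_top UNIV.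
        finite (insert 0 (Suc ` F)) \<and> X \<subseteq> insert 0 (Suc ` F) \<and> insert 0 (Suc ` F) \<subseteq> UNIV"
      unfolding eventually_finite_subsets_at_top by (intro exI[of _ "Suc -` X"]) auto
  qed
  from filterlim_compose[OF _ this, of "\<lambda>F. N (sum c F - s)" "nhds 0"]
  have "((\<lambda>F. N (sum c (insert 0 (Suc ` F)) - s)) \<longlongrightarrow> 0) (finite_subsets_at_top UNIV)"
    using assms by (simp add: sums_in_def)
  moreover have "\<forall>\<^sub>F F in finite_subsets_at_top UNIV.
      N (sum c (insert 0 (Suc ` F)) - s) = N ((\<Sum>n\<in>F. c (Suc n)) - (s - c 0))"
    by (intro eventually_finite_subsets_at_top_weakI) (simp add: sum.reindex algebra_simps)
  ultimately have "((\<lambda>F. N ((\<Sum>n\<in>F. c (Suc n)) - (s - c 0))) \<longlongrightarrow> 0) (finite_subsets_at_top UNIV)"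
    by (rule Lim_transform_eventually)
  with assms show ?thesis by (simp add: sums_in_def)
qed

context complex_banach_subspace
begin

lemma ell1_const:
  assumes "x \<in> V"
  shows "(\<lambda>n. if n = 0 then x else 0) \<in> ell1 V N"
    "fourier_sum smul V N (\<lambda>n. if n = 0 then x else 0) t = x"
proof -
  have "((\<lambda>n. N (if n = 0 then x else 0)) has_sum N x) (UNIV :: int set)"
    by (rule has_sum_finite_neutralI[of "{0}"]) auto
  with assms show "(\<lambda>n. if n = 0 then x else 0) \<in> ell1 V N"
    by (auto simp: ell1_def summable_on_def)
  have "\<forall>\<^sub>F F in finite_subsets_at_top UNIV.
      0 = N ((\<Sum>n\<in>F. smul (cis (of_int n * t)) (if n = 0 then x else 0)) - x)"
    unfolding eventually_finite_subsets_at_top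
  proof (intro exI[of _ "{0}"], safe)
    fix F :: "int set" assume "finite F" "{0} \<subseteq> F"
    then have "(\<Sum>n\<in>F. smul (cis (of_int n * t)) (if n = 0 then x else 0)) =
        (\<Sum>n\<in>{0}. smul (cis (of_int n * t)) (if n = 0 then x else 0))"
      by (intro sum.mono_neutral_right) auto
    then show "0 = N ((\<Sum>n\<in>F. smul (cis (of_int n * t)) (if n = 0 then x else 0)) - x)" by simp
  qed auto
  then have "((\<lambda>F. N ((\<Sum>n\<in>F. smul (cis (of_int n * t)) (if n = 0 then x else 0)) - x)) \<longlongrightarrow> 0)
      (finite_subsets_at_top UNIV)"
    by (rule Lim_transform_eventually[OF tendsto_const])
  then show "fourier_sum smul V N (\<lambda>n. if n = 0 then x else 0) t = x"
    using assms by (intro fourier_sum_eqI) (auto simp: sums_in_def smul_mem)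
qed

lemma wiener_space_diff:
  assumes "f \<in> wiener_space smul V N" "g \<in> wiener_space smul V N"
  shows "(\<lambda>t. f t - g t) \<in> wiener_space smul V N"
proof -
  interpret L: complex_normed_subspace "\<lambda>z c n. smul z (c n)" "ell1 V N" "ell1_norm N"
    by (rule complex_normed_subspace_ell1)
  from assms obtain c d where cd: "c \<in> ell1 V N" "d \<in> ell1 V N"
    "f = fourier_sum smul V N c" "g = fourier_sum smul V N d"
    by (auto simp: wiener_space_eq)
  have "(\<lambda>t. f t - g t) = fourier_sum smul V N (c - d)"
    using cd by (simp add: fun_eq_iff fourier_sum_diff del: minus_apply)
  with L.diff_mem[OF cd(1,2)] show ?thesis by (auto simp: wiener_space_eq)
qed

lemma wiener_space_const: "x \<in> V \<Longrightarrow> (\<lambda>_. x) \<in> wiener_space smul V N"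
  unfolding wiener_space_eq
  by (rule image_eqI[OF _ ell1_const(1)]) (auto simp: ell1_const(2) fun_eq_iff)

lemma wiener_space_smul:
  assumes "f \<in> wiener_space (*) UNIV cmod" "g \<in> wiener_space smul V N"
  shows "(\<lambda>t. smul (f t) (g t)) \<in> wiener_space smul V N"
proof -
  from assms obtain c d where cd: "c \<in> ell1 UNIV cmod" "d \<in> ell1 V N"
    "f = complex_fourier_sum c" "g = fourier_sum smul V N d"
    using complex_banach_subspace.wiener_space_eq[OF complex_banach_subspace_complex]
    by (auto simp: wiener_space_eq)
  obtain e where "e \<in> ell1 V N"
    "\<And>t. fourier_sum smul V N e t = smul (complex_fourier_sum c t) (fourier_sum smul V N d t)"
    by (rule ell1_convolution[OF complex_banach_subspace_complex complex_banach_subspace_axioms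
          complex_banach_subspace_axioms, where B = smul and C = 1, OF _ _ _ _ _ _ cd(1,2)])
      (auto simp: smul_mem scale_left_distrib scale_right_distrib norm_scale mult.commute)
  with cd show ?thesis by (auto simp: wiener_space_eq fun_eq_iff intro!: image_eqI[of _ _ e])
qed

end

context banach_inductive_limit
begin

text \<open>
  The open unit ball of the larger space meets the smaller one in a neighbourhood of \<open>0\<close>, by comparison of
  the topologies; scaling then gives the bound.
\<close>

lemma inclusion_bounded:
  assumes "\<alpha> \<in> I" "\<beta> \<in> I" "X \<alpha> \<subseteq> X \<beta>"
  obtains C where "\<And>x. x \<in> X \<alpha> \<Longrightarrow> nrm \<beta> x \<le> C * nrm \<alpha> x"
proof -
  interpret A: complex_banach_subspace smul "X \<alpha>" "nrm \<alpha>" by (rule banach) fact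
  interpret B: complex_banach_subspace smul "X \<beta>" "nrm \<beta>" by (rule banach) fact
  interpret MA: Metric_space "X \<alpha>" "norm_dist (X \<alpha>) (nrm \<alpha>)" by (rule A.Metric_space_norm_dist)
  interpret MB: Metric_space "X \<beta>" "norm_dist (X \<beta>) (nrm \<beta>)" by (rule B.Metric_space_norm_dist)
  define U where "U = MB.mball 0 1 \<inter> X \<alpha>"
  have "openin (subtopology (norm_topology (X \<beta>) (nrm \<beta>)) (X \<alpha>)) U"
    unfolding U_def norm_topology_def by (auto simp: openin_subtopology)
  then have "openin MA.mtopology U"
    using coarser[OF assms] by (simp add: norm_topology_def)
  moreover have "0 \<in> U" by (simp add: U_def norm_dist_def)
  ultimately obtain r where r: "r > 0" "MA.mball 0 r \<subseteq> U"
    unfolding MA.openin_mtopology by blast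
  have "nrm \<beta> x \<le> (2 / r) * nrm \<alpha> x" if x: "x \<in> X \<alpha>" for x
  proof (cases "x = 0")
    case False
    with x A.norm_nonneg[of x] A.norm_eq_0[of x] have pos: "nrm \<alpha> x > 0" by linarith
    define q where "q = r / (2 * nrm \<alpha> x)"
    have q: "q > 0" using r pos by (simp add: q_def)
    have y: "smul (of_real q) x \<in> X \<alpha>" using x by (rule A.smul_mem)
    have "nrm \<alpha> (smul (of_real q) x) < r"
    proof -
      have "nrm \<alpha> (smul (of_real q) x) = q * nrm \<alpha> x" using x q by (simp add: A.norm_scale)
      then show ?thesis using r pos by (simp add: q_def)
    qed
    then have "smul (of_real q) x \<in> MA.mball 0 r"
      using y A.norm_minus[OF y] by (simp add: norm_dist_def)
    with r have "smul (of_real q) x \<in> MB.mball 0 1" by (auto simp: U_def)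
    then have "nrm \<beta> (smul (of_real q) x) < 1"
      using y assms(3) B.norm_minus[of "smul (of_real q) x"] by (auto simp: norm_dist_def)
    then have "q * nrm \<beta> x < 1"
      using x assms(3) q B.norm_scale[of x "of_real q"] by auto
    then show ?thesis using pos r by (simp add: q_def field_simps)
  qed simp
  with that show ?thesis by blast
qed

lemma wiener_space_mono:
  assumes "\<alpha> \<in> I" "\<beta> \<in> I" "X \<alpha> \<subseteq> X \<beta>"
  shows "wiener_space smul (X \<alpha>) (nrm \<alpha>) \<subseteq> wiener_space smul (X \<beta>) (nrm \<beta>)"
proof -
  interpret A: complex_banach_subspace smul "X \<alpha>" "nrm \<alpha>" by (rule banach) fact
  interpret B: complex_banach_subspace smul "X \<beta>" "nrm \<beta>" by (rule banach) fact
  obtain C where C: "\<And>x. x \<in> X \<alpha> \<Longrightarrow> nrm \<beta> x \<le> C * nrm \<alpha> x"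
    using inclusion_bounded[OF assms] by blast
  note image = ell1_bounded_linear_image[OF A.complex_banach_subspace_axioms
      B.complex_banach_subspace_axioms, where T = "\<lambda>x. x" and C = C]
  have "fourier_sum smul (X \<alpha>) (nrm \<alpha>) c \<in> wiener_space smul (X \<beta>) (nrm \<beta>)"
    if c: "c \<in> ell1 (X \<alpha>) (nrm \<alpha>)" for c
    unfolding B.wiener_space_eq
  proof (rule image_eqI)
    show "c \<in> ell1 (X \<beta>) (nrm \<beta>)" by (rule image(1)[OF _ _ _ C c]) (use assms in auto)
    have "fourier_sum smul (X \<beta>) (nrm \<beta>) c t = fourier_sum smul (X \<alpha>) (nrm \<alpha>) c t" for t
      by (rule image(3)[OF _ _ _ C c]) (use assms in auto)
    then show "fourier_sum smul (X \<alpha>) (nrm \<alpha>) c = fourier_sum smul (X \<beta>) (nrm \<beta>) c" by auto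
  qed
  then show ?thesis by (auto simp: A.wiener_space_eq)
qed

lemma obtain_index: obtains \<alpha> where "\<alpha> \<in> I" "x \<in> X \<alpha>"
  using union by blast

lemma wiener_algebra_diff:
  assumes "f \<in> wiener_algebra smul I X nrm" "g \<in> wiener_algebra smul I X nrm"
  shows "(\<lambda>t. f t - g t) \<in> wiener_algebra smul I X nrm"
proof -
  from assms obtain \<alpha> \<beta> where f: "\<alpha> \<in> I" "f \<in> wiener_space smul (X \<alpha>) (nrm \<alpha>)"
    and g: "\<beta> \<in> I" "g \<in> wiener_space smul (X \<beta>) (nrm \<beta>)"
    by (auto simp: wiener_algebra_def)
  obtain \<gamma> where \<gamma>: "\<gamma> \<in> I" "X \<alpha> \<subseteq> X \<gamma>" "X \<beta> \<subseteq> X \<gamma>" using directed f g by blast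
  interpret C: complex_banach_subspace smul "X \<gamma>" "nrm \<gamma>" by (rule banach) fact
  have "(\<lambda>t. f t - g t) \<in> wiener_space smul (X \<gamma>) (nrm \<gamma>)"
    using f g \<gamma> wiener_space_mono by (intro C.wiener_space_diff) blast+
  with \<gamma> show ?thesis by (auto simp: wiener_algebra_def)
qed

lemma wiener_algebra_zero: "(\<lambda>_. 0) \<in> wiener_algebra smul I X nrm"
proof -
  obtain \<alpha> where "\<alpha> \<in> I" "0 \<in> X \<alpha>" by (rule obtain_index)
  then show ?thesis
    using complex_banach_subspace.wiener_space_const[OF banach] by (auto simp: wiener_algebra_def)
qed

lemma wiener_algebra_smul:
  assumes "f \<in> wiener_space (*) UNIV cmod" "g \<in> wiener_algebra smul I X nrm"
  shows "(\<lambda>t. smul (f t) (g t)) \<in> wiener_algebra smul I X nrm"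
  using assms complex_banach_subspace.wiener_space_smul[OF banach]
  by (auto simp: wiener_algebra_def)

lemma wiener_algebra_periodic:
  assumes "f \<in> wiener_algebra smul I X nrm"
  shows "f (t + 2 * pi * of_int j) = f t"
  using assms complex_banach_subspace.wiener_space_eq[OF banach]
    complex_banach_subspace.fourier_sum_periodic[OF banach]
  by (auto simp: wiener_algebra_def)

end

context strong_algebra
begin

text \<open>
  The index \<open>\<gamma>\<close> can be taken above any given \<open>\<beta>\<close>, because the strong inequality holds for all indices beyond \<open>h(\<alpha>)\<close>.
\<close>

lemma strong_above:
  assumes "\<alpha> \<in> I" "\<beta> \<in> I"
  obtains \<gamma> C where "\<gamma> \<in> I" "X \<beta> \<subseteq> X \<gamma>" "C > 0"
    "\<And>a b. a \<in> X \<alpha> \<Longrightarrow> b \<in> X \<gamma> \<Longrightarrow> a * b \<in> X \<gamma> \<and> nrm \<gamma> (a * b) \<le> C * nrm \<alpha> a * nrm \<gamma> b"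
    "\<And>a b. a \<in> X \<alpha> \<Longrightarrow> b \<in> X \<gamma> \<Longrightarrow> b * a \<in> X \<gamma> \<and> nrm \<gamma> (b * a) \<le> C * nrm \<alpha> a * nrm \<gamma> b"
proof -
  obtain h where h: "h \<in> I" "\<And>\<gamma>. \<gamma> \<in> I \<Longrightarrow> X h \<subseteq> X \<gamma> \<Longrightarrow> (\<exists>C>0. \<forall>a\<in>X \<alpha>. \<forall>b\<in>X \<gamma>.
         a * b \<in> X \<gamma> \<and> nrm \<gamma> (a * b) \<le> C * nrm \<alpha> a * nrm \<gamma> b \<and>
         b * a \<in> X \<gamma> \<and> nrm \<gamma> (b * a) \<le> C * nrm \<alpha> a * nrm \<gamma> b)"
    using strong[OF assms(1)] by blast
  obtain \<gamma> where \<gamma>: "\<gamma> \<in> I" "X h \<subseteq> X \<gamma>" "X \<beta> \<subseteq> X \<gamma>" using directed h(1) assms(2) by blast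
  then obtain C where "C > 0" "\<forall>a\<in>X \<alpha>. \<forall>b\<in>X \<gamma>.
         a * b \<in> X \<gamma> \<and> nrm \<gamma> (a * b) \<le> C * nrm \<alpha> a * nrm \<gamma> b \<and>
         b * a \<in> X \<gamma> \<and> nrm \<gamma> (b * a) \<le> C * nrm \<alpha> a * nrm \<gamma> b"
    using h(2) by metis
  with \<gamma> that show ?thesis by blast
qed

lemma wiener_algebra_mult_const:
  assumes "g \<in> wiener_algebra smul I X nrm"
  shows "(\<lambda>t. x * g t) \<in> wiener_algebra smul I X nrm"
proof -
  from assms obtain \<beta> where \<beta>: "\<beta> \<in> I" "g \<in> wiener_space smul (X \<beta>) (nrm \<beta>)"
    by (auto simp: wiener_algebra_def)
  obtain \<alpha> where \<alpha>: "\<alpha> \<in> I" "x \<in> X \<alpha>" by (rule obtain_index)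
  obtain \<gamma> C where \<gamma>: "\<gamma> \<in> I" "X \<beta> \<subseteq> X \<gamma>" and C: 
    "\<And>a b. a \<in> X \<alpha> \<Longrightarrow> b \<in> X \<gamma> \<Longrightarrow> a * b \<in> X \<gamma> \<and> nrm \<gamma> (a * b) \<le> C * nrm \<alpha> a * nrm \<gamma> b"
    using strong_above[OF \<alpha>(1) \<beta>(1)] by metis
  interpret G: complex_banach_subspace smul "X \<gamma>" "nrm \<gamma>" by (rule banach) fact
  obtain c where c: "c \<in> ell1 (X \<gamma>) (nrm \<gamma>)" "g = fourier_sum smul (X \<gamma>) (nrm \<gamma>) c"
    using wiener_space_mono[OF \<beta>(1) \<gamma>] \<beta>(2) by (auto simp: G.wiener_space_eq)
  note image = ell1_bounded_linear_image[OF G.complex_banach_subspace_axioms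
      G.complex_banach_subspace_axioms, where T = "\<lambda>y. x * y" and C = "C * nrm \<alpha> x", OF _ _ _ _ c(1)]
  have "(\<lambda>n. x * c n) \<in> ell1 (X \<gamma>) (nrm \<gamma>)"
    by (rule image(1)) (use C \<alpha> in \<open>auto simp: distrib_left scale_mult_right\<close>)
  moreover have "fourier_sum smul (X \<gamma>) (nrm \<gamma>) (\<lambda>n. x * c n) t = x * g t" for t
    unfolding c(2) by (rule image(3)) (use C \<alpha> in \<open>auto simp: distrib_left scale_mult_right\<close>)
  ultimately have "(\<lambda>t. x * g t) \<in> wiener_space smul (X \<gamma>) (nrm \<gamma>)"
    unfolding G.wiener_space_eq by (intro image_eqI[of _ _ "\<lambda>n. x * c n"]) (auto simp: fun_eq_iff)
  with \<gamma> show ?thesis by (auto simp: wiener_algebra_def)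
qed

end


section \<open>Inversion in the Wiener algebra\<close>

context unital_strong_algebra
begin

text \<open>
  No \<open>Y\<^sub>\<delta>\<close> need be an algebra, so the powers of \<open>e\<close> may leave the space that contains \<open>e\<close>.  But multiplication by \<open>e\<close>
  is a bounded operator on a space \<open>Y\<^sub>\<gamma>\<close> further up that contains \<open>1\<close>.  When \<open>e\<close> is small this operator is a contraction,
  and the Neumann series is applied to the vector \<open>1\<close> instead of being formed in an algebra.
\<close>

lemma neumann_inverse:
  assumes "\<delta> \<in> I"
  obtains \<epsilon> where "\<epsilon> > 0"
    "\<And>e. e \<in> ell1 (X \<delta>) (nrm \<delta>) \<Longrightarrow> ell1_norm (nrm \<delta>) e < \<epsilon> \<Longrightarrow>
       \<exists>y\<in>wiener_algebra smul I X nrm. \<forall>t. (1 - fourier_sum smul (X \<delta>) (nrm \<delta>) e t) * y t = 1"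
proof -
  obtain \<beta> where \<beta>: "\<beta> \<in> I" "1 \<in> X \<beta>" by (rule obtain_index)
  obtain \<gamma> C where \<gamma>: "\<gamma> \<in> I" "X \<beta> \<subseteq> X \<gamma>" "C > 0" and
    mult: "\<And>a b. a \<in> X \<delta> \<Longrightarrow> b \<in> X \<gamma> \<Longrightarrow> a * b \<in> X \<gamma> \<and> nrm \<gamma> (a * b) \<le> C * nrm \<delta> a * nrm \<gamma> b"
    using strong_above[OF assms \<beta>(1)] by metis
  interpret D: complex_banach_subspace smul "X \<delta>" "nrm \<delta>" by (rule banach) fact
  interpret G: complex_banach_subspace smul "X \<gamma>" "nrm \<gamma>" by (rule banach) fact
  interpret LD: complex_normed_subspace "\<lambda>z c n. smul z (c n)" "ell1 (X \<delta>) (nrm \<delta>)" "ell1_norm (nrm \<delta>)"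
    by (rule D.complex_normed_subspace_ell1)
  interpret LG: complex_normed_subspace "\<lambda>z c n. smul z (c n)" "ell1 (X \<gamma>) (nrm \<gamma>)" "ell1_norm (nrm \<gamma>)"
    by (rule G.complex_normed_subspace_ell1)
  have "\<exists>y\<in>wiener_algebra smul I X nrm. \<forall>t. (1 - fourier_sum smul (X \<delta>) (nrm \<delta>) e t) * y t = 1"
    if e: "e \<in> ell1 (X \<delta>) (nrm \<delta>)" and small: "ell1_norm (nrm \<delta>) e < 1 / C" for e
  proof -
    let ?D = "fourier_sum smul (X \<delta>) (nrm \<delta>)" and ?G = "fourier_sum smul (X \<gamma>) (nrm \<gamma>)"
    define q where "q = C * ell1_norm (nrm \<delta>) e"
    have q: "0 \<le> q" "q < 1"
      using small \<gamma>(3) LD.norm_nonneg[OF e] by (auto simp: q_def field_simps)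
    have "\<exists>d'\<in>ell1 (X \<gamma>) (nrm \<gamma>). ell1_norm (nrm \<gamma>) d' \<le> q * ell1_norm (nrm \<gamma>) d \<and> (\<forall>t. ?G d' t = ?D e t * ?G d t)"
      if d: "d \<in> ell1 (X \<gamma>) (nrm \<gamma>)" for d
    proof -
      obtain d' where "d' \<in> ell1 (X \<gamma>) (nrm \<gamma>)"
        "ell1_norm (nrm \<gamma>) d' \<le> C * ell1_norm (nrm \<delta>) e * ell1_norm (nrm \<gamma>) d"
        "\<And>t. ?G d' t = ?D e t * ?G d t"
        by (rule ell1_convolution[OF D.complex_banach_subspace_axioms G.complex_banach_subspace_axioms
          G.complex_banach_subspace_axioms, where B = "(*)" and C = C, OF _ _ _ _ _ _ e d])
          (auto simp: mult distrib_left distrib_right scale_mult_left scale_mult_right)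
      then show ?thesis by (auto simp: q_def)
    qed
    then obtain \<Phi> where \<Phi>: "\<And>d. d \<in> ell1 (X \<gamma>) (nrm \<gamma>) \<Longrightarrow> \<Phi> d \<in> ell1 (X \<gamma>) (nrm \<gamma>)"
      "\<And>d. d \<in> ell1 (X \<gamma>) (nrm \<gamma>) \<Longrightarrow> ell1_norm (nrm \<gamma>) (\<Phi> d) \<le> q * ell1_norm (nrm \<gamma>) d"
      "\<And>d t. d \<in> ell1 (X \<gamma>) (nrm \<gamma>) \<Longrightarrow> ?G (\<Phi> d) t = ?D e t * ?G d t"
      by metis
    define u :: "int \<Rightarrow> 'a" where "u = (\<lambda>n. if n = 0 then 1 else 0)"
    have u: "u \<in> ell1 (X \<gamma>) (nrm \<gamma>)" "\<And>t. ?G u t = 1"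
      using G.ell1_const[of 1] \<beta> \<gamma> by (auto simp: u_def)
    define Z where "Z m = (\<Phi> ^^ m) u" for m
    have Z: "Z m \<in> ell1 (X \<gamma>) (nrm \<gamma>)" for m
      by (induction m) (auto simp: Z_def u \<Phi>)
    have Z_norm: "ell1_norm (nrm \<gamma>) (Z m) \<le> q ^ m * ell1_norm (nrm \<gamma>) u" for m
    proof (induction m)
      case (Suc m)
      have "ell1_norm (nrm \<gamma>) (Z (Suc m)) \<le> q * ell1_norm (nrm \<gamma>) (Z m)"
        using \<Phi>(2)[OF Z] by (simp add: Z_def)
      also have "\<dots> \<le> q * (q ^ m * ell1_norm (nrm \<gamma>) u)"
        using q Suc by (intro mult_left_mono)
      finally show ?case by simp
    qed (simp add: Z_def)
    have "summable (\<lambda>m. q ^ m * ell1_norm (nrm \<gamma>) u)"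
      using q by (intro summable_mult2 summable_geometric) auto
    then have "summable (\<lambda>m. norm (ell1_norm (nrm \<gamma>) (Z m)))"
      by (rule summable_comparison_test[rotated]) (use Z_norm LG.norm_nonneg[OF Z] in auto)
    then have sZ: "(\<lambda>m. ell1_norm (nrm \<gamma>) (Z m)) summable_on UNIV"
      by (rule norm_summable_imp_summable_on)
    obtain y where y: "y \<in> ell1 (X \<gamma>) (nrm \<gamma>)"
      "\<And>t. sums_in (X \<gamma>) (nrm \<gamma>) (\<lambda>m. ?G (Z m) t) (?G y t)"
      using G.fourier_sum_series[OF Z sZ] by blast
    have "(1 - ?D e t) * ?G y t = 1" for t
    proof -
      have mult_e: "?D e t * x \<in> X \<gamma>" "nrm \<gamma> (?D e t * x) \<le> C * nrm \<delta> (?D e t) * nrm \<gamma> x"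
        if "x \<in> X \<gamma>" for x
        using mult[OF D.fourier_sum_mem[OF e, of t] that] by auto
      have "sums_in (X \<gamma>) (nrm \<gamma>) (\<lambda>m. ?D e t * ?G (Z m) t) (?D e t * ?G y t)"
        by (rule sums_in_bounded_linear_image[OF G.complex_normed_subspace_axioms
            G.complex_normed_subspace_axioms _ _ _ y(2), where T = "\<lambda>x. ?D e t * x" and C = "C * nrm \<delta> (?D e t)"])
          (simp_all add: mult_e distrib_left)
      moreover have "?D e t * ?G (Z m) t = ?G (Z (Suc m)) t" for m
        using \<Phi>(3)[OF Z] by (simp add: Z_def)
      moreover have "sums_in (X \<gamma>) (nrm \<gamma>) (\<lambda>m. ?G (Z (Suc m)) t) (?G y t - ?G (Z 0) t)"
        by (rule sums_in_Suc[OF y(2)]) (intro G.diff_mem G.fourier_sum_mem y Z)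
      ultimately have eq: "?D e t * ?G y t = ?G y t - ?G (Z 0) t"
        by (intro G.sums_in_unique) simp_all
      have "(1 - ?D e t) * ?G y t = ?G y t - ?D e t * ?G y t"
        by (simp only: left_diff_distrib mult_1_left)
      also have "\<dots> = ?G (Z 0) t" unfolding eq by simp
      also have "\<dots> = 1" by (simp add: Z_def u(2))
      finally show ?thesis .
    qed
    moreover have "?G y \<in> wiener_algebra smul I X nrm"
    proof -
      have "?G y \<in> wiener_space smul (X \<gamma>) (nrm \<gamma>)" using y(1) by (simp add: G.wiener_space_eq)
      with \<gamma>(1) show ?thesis by (auto simp: wiener_algebra_def)
    qed
    ultimately show ?thesis by blast
  qed
  with that[of "1 / C"] \<gamma>(3) show ?thesis by simp
qed

text \<open>
  With \<open>b\<close> a right inverse of \<open>a t0\<close>, one has \<open>a t * b = 1 + (a t - a t0) * b\<close>.  Damping the perturbation by a wide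
  cut-off makes it small in the Wiener norm without changing it near \<open>t0\<close>, so it can be inverted by
  a Neumann series.  Multiplication by the narrow cut-off \<open>\<phi>\<close> then
  confines the result to the region where nothing was changed.
\<close>

lemma local_right_inverse:
  assumes a: "a \<in> wiener_algebra smul I X nrm" and b: "a t0 * b = 1"
  obtains w \<phi> g where "w > 0" "\<phi> \<in> wiener_space (*) UNIV cmod" "g \<in> wiener_algebra smul I X nrm"
    "\<And>t. a t * g t = smul (\<phi> t) 1" "\<And>t. \<bar>t - t0\<bar> \<le> w \<Longrightarrow> \<phi> t = 1"
proof -
  from a obtain \<alpha> where \<alpha>: "\<alpha> \<in> I" "a \<in> wiener_space smul (X \<alpha>) (nrm \<alpha>)"
    by (auto simp: wiener_algebra_def)
  obtain \<beta> where \<beta>: "\<beta> \<in> I" "b \<in> X \<beta>" by (rule obtain_index)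
  obtain \<delta> C where \<delta>: "\<delta> \<in> I" "X \<beta> \<subseteq> X \<delta>" "C > 0" and mult:
    "\<And>x y. x \<in> X \<alpha> \<Longrightarrow> y \<in> X \<delta> \<Longrightarrow> x * y \<in> X \<delta> \<and> nrm \<delta> (x * y) \<le> C * nrm \<alpha> x * nrm \<delta> y"
    using strong_above[OF \<alpha>(1) \<beta>(1)] by metis
  interpret A: complex_banach_subspace smul "X \<alpha>" "nrm \<alpha>" by (rule banach) fact
  interpret D: complex_banach_subspace smul "X \<delta>" "nrm \<delta>" by (rule banach) fact
  have b_mem: "b \<in> X \<delta>" using \<beta> \<delta> by blast
  obtain c where c: "c \<in> ell1 (X \<alpha>) (nrm \<alpha>)" "a = fourier_sum smul (X \<alpha>) (nrm \<alpha>) c"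
    using \<alpha>(2) by (auto simp: A.wiener_space_eq)
  obtain \<epsilon> where \<epsilon>: "\<epsilon> > 0" "\<And>e. e \<in> ell1 (X \<delta>) (nrm \<delta>) \<Longrightarrow> ell1_norm (nrm \<delta>) e < \<epsilon> \<Longrightarrow>
       \<exists>y\<in>wiener_algebra smul I X nrm. \<forall>t. (1 - fourier_sum smul (X \<delta>) (nrm \<delta>) e t) * y t = 1"
    using neumann_inverse[OF \<delta>(1)] by metis
  \<comment> \<open>Adding 1 keeps the constant positive also when b = 0, that is, in the zero ring.\<close>
  define K where "K = C * nrm \<delta> b + 1"
  have K: "K > 0" using \<delta>(3) D.norm_nonneg[OF b_mem] by (simp add: K_def add_nonneg_pos)
  have range: "eventually (\<lambda>w::real. 0 < w \<and> w \<le> 1/2) (at_right 0)"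
    unfolding eventually_at_right_field by (intro exI[of _ "1/2"]) auto
  have "\<epsilon> / K > 0" using \<epsilon>(1) K by simp
  from eventually_conj[OF range A.cutoff_increment_small[OF c(1) this, of t0]]
  have "eventually (\<lambda>w. (0 < w \<and> w \<le> 1/2) \<and> (\<exists>z\<in>ell1 (X \<alpha>) (nrm \<alpha>). ell1_norm (nrm \<alpha>) z < \<epsilon> / K \<and>
    (\<forall>t. fourier_sum smul (X \<alpha>) (nrm \<alpha>) z t = smul (cutoff w (t - t0)) (a t - a t0)))) (at_right 0)"
    by (simp add: c(2))
  from eventually_happens'[OF _ this]
  obtain w z where w: "0 < w" "w \<le> 1/2" and z: "z \<in> ell1 (X \<alpha>) (nrm \<alpha>)" "ell1_norm (nrm \<alpha>) z < \<epsilon> / K"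
    "\<And>t. fourier_sum smul (X \<alpha>) (nrm \<alpha>) z t = smul (cutoff w (t - t0)) (a t - a t0)"
    by auto
  note image = ell1_bounded_linear_image[OF A.complex_banach_subspace_axioms D.complex_banach_subspace_axioms,
      where T = "\<lambda>x. - (x * b)" and C = K, OF _ _ _ _ z(1)]
  have T_bound: "nrm \<delta> (- (x * b)) \<le> K * nrm \<alpha> x" if "x \<in> X \<alpha>" for x
    using mult[OF that b_mem] D.norm_minus[of "x * b"] A.norm_nonneg[OF that]
    by (simp add: K_def algebra_simps)
  define e where "e = (\<lambda>n. - (z n * b))"
  have e: "e \<in> ell1 (X \<delta>) (nrm \<delta>)" "ell1_norm (nrm \<delta>) e \<le> K * ell1_norm (nrm \<alpha>) z"
    "fourier_sum smul (X \<delta>) (nrm \<delta>) e t = - (smul (cutoff w (t - t0)) (a t - a t0) * b)" for t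
    unfolding e_def z(3)[symmetric]
    by (rule image; use mult b_mem T_bound in \<open>auto simp: D.minus_mem distrib_right scale_mult_left\<close>)+
  have "ell1_norm (nrm \<delta>) e < \<epsilon>"
    using e(2) z(2) K by (simp add: field_simps)
  from \<epsilon>(2)[OF e(1) this] obtain y where y: "y \<in> wiener_algebra smul I X nrm"
    "\<And>t. (1 + smul (cutoff w (t - t0)) (a t - a t0) * b) * y t = 1"
    by (auto simp: e(3))
  define \<phi> where "\<phi> t = cutoff (w / 2) (t - t0)" for t
  have "\<phi> = complex_fourier_sum (modulate t0 (cutoff_coeff (w / 2)))"
    by (simp add: \<phi>_def fun_eq_iff cutoff_def modulate(2))
  moreover have "modulate t0 (cutoff_coeff (w / 2)) \<in> ell1 UNIV cmod"
    using w by (intro modulate(1) cutoff_coeff_ell1) auto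
  ultimately have \<phi>: "\<phi> \<in> wiener_space (*) UNIV cmod"
    by (simp add: complex.wiener_space_eq)
  show ?thesis
  proof (rule that)
    show "w / 2 > 0" "\<phi> \<in> wiener_space (*) UNIV cmod" using w \<phi> by auto
    show "(\<lambda>t. smul (\<phi> t) (b * y t)) \<in> wiener_algebra smul I X nrm"
      by (intro wiener_algebra_smul \<phi> wiener_algebra_mult_const y)
    show "a t * smul (\<phi> t) (b * y t) = smul (\<phi> t) 1" for t
    proof (cases "\<phi> t = 0")
      case False
      then have "cutoff w (t - t0) = 1"
        using cutoff_nested[of "w / 2" "t - t0"] w by (simp add: \<phi>_def)
      with y(2)[of t] b have "a t * (b * y t) = 1"
        by (simp add: left_diff_distrib flip: mult.assoc)
      then show ?thesis by (simp add: scale_mult_right)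
    qed simp
    show "\<phi> t = 1" if "\<bar>t - t0\<bar> \<le> w / 2" for t
      unfolding \<phi>_def using w that by (intro cutoff_eq_1) auto
  qed
qed

text \<open>
  The scalar Wiener functions \<open>\<phi>\<close> for which \<open>\<phi> \<cdot> 1\<close> is a right multiple of \<open>a\<close> form an ideal.  In
  particular \<open>\<phi> + \<phi>' - \<phi> \<phi>'\<close>, which is \<open>1\<close> wherever \<open>\<phi>\<close> or \<open>\<phi>'\<close> is, stays in it.
  This patches finitely many local inverses together without a partition of unity.
\<close>

lemma global_right_inverse:
  assumes a: "a \<in> wiener_algebra smul I X nrm"
    and b: "\<And>t. \<exists>b. a t * b = 1"
  obtains g where "g \<in> wiener_algebra smul I X nrm" "\<And>t. t \<in> {-pi..pi} \<Longrightarrow> a t * g t = 1"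
proof -
  define P where "P S \<longleftrightarrow> (\<exists>\<phi>\<in>wiener_space (*) UNIV cmod. \<exists>g\<in>wiener_algebra smul I X nrm.
      (\<forall>t. a t * g t = smul (\<phi> t) 1) \<and> (\<forall>t\<in>S. \<phi> t = 1))" for S
  have P_empty: "P {}"
    unfolding P_def
    by (intro bexI[OF _ complex.wiener_space_const[of 0]] bexI[OF _ wiener_algebra_zero]) auto
  have P_Un: "P (S \<union> S')" if "P S" "P S'" for S S'
  proof -
    from that obtain \<phi> g \<phi>' g' where
      1: "\<phi> \<in> wiener_space (*) UNIV cmod" "g \<in> wiener_algebra smul I X nrm"
         "\<And>t. a t * g t = smul (\<phi> t) 1" "\<And>t. t \<in> S \<Longrightarrow> \<phi> t = 1" and
      2: "\<phi>' \<in> wiener_space (*) UNIV cmod" "g' \<in> wiener_algebra smul I X nrm"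
         "\<And>t. a t * g' t = smul (\<phi>' t) 1" "\<And>t. t \<in> S' \<Longrightarrow> \<phi>' t = 1"
      unfolding P_def by metis
    show ?thesis
      unfolding P_def
    proof (intro bexI conjI allI ballI)
      show "(\<lambda>t. \<phi> t - (\<phi> t * \<phi>' t - \<phi>' t)) \<in> wiener_space (*) UNIV cmod"
        by (intro complex.wiener_space_diff complex.wiener_space_smul 1 2)
      show "(\<lambda>t. g t - (smul (\<phi> t) (g' t) - g' t)) \<in> wiener_algebra smul I X nrm"
        by (intro wiener_algebra_diff wiener_algebra_smul 1 2)
      show "a t * (g t - (smul (\<phi> t) (g' t) - g' t)) = smul (\<phi> t - (\<phi> t * \<phi>' t - \<phi>' t)) 1" for t
        by (simp add: right_diff_distrib scale_mult_right 1 2 scale_left_diff_distrib)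
      show "\<phi> t - (\<phi> t * \<phi>' t - \<phi>' t) = 1" if "t \<in> S \<union> S'" for t
        using that 1(4)[of t] 2(4)[of t] by auto
    qed
  qed
  have "\<exists>w>0. P {t0 - w..t0 + w}" for t0
  proof -
    obtain b where "a t0 * b = 1" using assms(2) by blast
    then obtain w \<phi> g where "w > 0" "\<phi> \<in> wiener_space (*) UNIV cmod" "g \<in> wiener_algebra smul I X nrm"
      "\<And>t. a t * g t = smul (\<phi> t) 1" "\<And>t. \<bar>t - t0\<bar> \<le> w \<Longrightarrow> \<phi> t = 1"
      using local_right_inverse[OF a] by metis
    then show ?thesis unfolding P_def by (intro exI[of _ w]) (auto intro!: bexI[of _ \<phi>] bexI[of _ g])
  qed
  then obtain w where w: "\<And>t. w t > 0" "\<And>t. P {t - w t..t + w t}" by metis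
  obtain T where T: "finite T" "{-pi..pi} \<subseteq> (\<Union>t\<in>T. ball t (w t))"
  proof (rule compactE_image[of "{-pi..pi}" "{-pi..pi}" "\<lambda>t. ball t (w t)"])
    show "{-pi..pi} \<subseteq> (\<Union>t\<in>{-pi..pi}. ball t (w t))" using w by force
  qed (use that in auto)
  have "P (\<Union>t\<in>T. {t - w t..t + w t})"
    using T(1) by induction (auto intro: P_empty P_Un w)
  then obtain \<phi> g where g: "g \<in> wiener_algebra smul I X nrm" "\<And>t. a t * g t = smul (\<phi> t) 1"
    "\<And>t. t \<in> (\<Union>t\<in>T. {t - w t..t + w t}) \<Longrightarrow> \<phi> t = 1"
    unfolding P_def by metis
  have "ball t (w t) \<subseteq> {t - w t..t + w t}" for t by (auto simp: dist_real_def)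
  then have "\<phi> t = 1" if "t \<in> {-pi..pi}" for t
    using T(2) that by (intro g(3)) blast
  with g that show ?thesis by simp
qed

text \<open>
  A right inverse suffices: since \<open>a t\<close> is two-sided invertible, its right inverse \<open>g t\<close> is the inverse.
\<close>

lemma wiener_invertible:
  assumes a: "a \<in> wiener_algebra smul I X nrm"
    and inv: "\<And>t. t \<in> {-pi..<pi} \<Longrightarrow> \<exists>b. a t * b = 1 \<and> b * a t = 1"
  shows "\<exists>g\<in>wiener_algebra smul I X nrm. \<forall>t. a t * g t = 1 \<and> g t * a t = 1"
proof -
  have inv': "\<exists>b. a t * b = 1 \<and> b * a t = 1" for t
    using shift_into_period[of t] inv wiener_algebra_periodic[OF a] by metis
  then obtain g where g: "g \<in> wiener_algebra smul I X nrm" "\<And>t. t \<in> {-pi..pi} \<Longrightarrow> a t * g t = 1"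
    using global_right_inverse[OF a] by metis
  have right: "a t * g t = 1" for t
  proof -
    obtain j where "t + 2 * pi * of_int j \<in> {-pi..<pi}" using shift_into_period by blast
    then have "t + 2 * pi * of_int j \<in> {-pi..pi}" by auto
    from g(2)[OF this] show ?thesis
      by (simp add: wiener_algebra_periodic[OF a] wiener_algebra_periodic[OF g(1)])
  qed
  have "g t * a t = 1" for t
  proof -
    obtain b where b: "a t * b = 1" "b * a t = 1" using inv' by blast
    have "b = b * (a t * g t)" by (simp add: right)
    also have "\<dots> = g t" using b by (simp flip: mult.assoc)
    finally show ?thesis using b by simp
  qed
  with right g(1) show ?thesis by blast
qed

end

theorem corollary5p7:
  fixes smul :: "complex \<Rightarrow> 'a::{ring, monoid_mult} \<Rightarrow> 'a"
    and I :: "'i set" and X :: "'i \<Rightarrow> 'a set" and nrm :: "'i \<Rightarrow> 'a \<Rightarrow> real"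
    and a :: "real \<Rightarrow> 'a"
  assumes "unital_strong_algebra smul I X nrm"
    and "a \<in> wiener_algebra smul I X nrm"
  shows "invertible_in (wiener_algebra smul I X nrm) a \<longleftrightarrow>
         (\<forall>t\<in>{-pi..<pi}. invertible_in UNIV (a t))"
proof -
  interpret unital_strong_algebra smul I X nrm by fact
  have "invertible_in (wiener_algebra smul I X nrm) a \<longleftrightarrow>
      (\<exists>g\<in>wiener_algebra smul I X nrm. \<forall>t. a t * g t = 1 \<and> g t * a t = 1)"
    using assms(2) by (auto simp: invertible_in_def fun_eq_iff)
  then show ?thesis
    using wiener_invertible[OF assms(2)] by (auto simp: invertible_in_def)
qed

end
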